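(* Suppose $d=1$ and consider the classic final-time data $\varphi(\xi,\eta)=\frac12(\eta+|\xi|)$. Let $u^\varepsilon(t,m,\xi,\eta)$ be the scaled value function defined by the dynamic programming principle (see context) with final-time data $\varphi$, and let $u(t,\xi,\eta)$ be the solution of $$u_t+\tfrac12 C_1^\#\Big\langle D^2u\,\frac{\nabla^\perp u}{u_\eta},\frac{\nabla^\perp u}{u_\eta}\Big\rangle=0\ \ (t<T),\qquad u(T,\xi,\eta)=\varphi(\xi,\eta),$$ where $C_1^\#=\frac12\big[(q(1)-r(1))^2+(q(0)-r(0))^2\big]$. Then there is a constant $C$ (independent of $\varepsilon$, $t$, and $T$) such that $$\big|u^\varepsilon(t,m,\xi,\eta)-u(t,\xi,\eta)\big|\le C\,\varepsilon|\log\varepsilon|\qquad\text{for } t<T,\ \xi\in\mathbb{R},\ \eta\in\mathbb{R},\ m\in\{0,1\},$$ whenever $\varepsilon>0$ is small enough and $t$ is such that $N=(T-t)/\varepsilon^2$ is an integer.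
   Context: The states are $m\in\{0,1\}$; for $b=\pm1$ the next state is $m_b=1$ if $b=1$ and $m_b=0$ if $b=-1$. Two experts are given by functions $q,r:\{0,1\}\to\mathbb{R}$ with $|q(m)|<1$ and $|r(m)|<1$ for all $m$, and $q(m)\ne r(m)$ for at least one $m$. For $\varepsilon>0$, $u^\varepsilon(t,m,\xi,\eta)$ is defined for times $t\le T$ with $(T-t)/\varepsilon^2$ a nonnegative integer, $m\in\{0,1\}$, $(\xi,\eta)\in\mathbb{R}^2$, by $u^\varepsilon(T,m,\xi,\eta)=\varphi(\xi,\eta)$ and, working backward in time, $$u^\varepsilon(t,m,\xi,\eta)=\min_{|f|\le1}\max_{b=\pm1}u^\varepsilon\big(t+\varepsilon^2,\,m_b,\,\xi+\varepsilon b[q(m)-r(m)],\,\eta+\varepsilon b[q(m)+r(m)-2f]\big).$$ Notation: $\nabla^\perp u=(-u_\eta,u_\xi)$ and $D^2u$ is the Hessian of $u$ in $(\xi,\eta)$. For the classic data, "the solution" of the final-value problem means $u(t,\xi,\eta)=\frac12\eta+\overline u(t,\xi)$, where $\overline u$ is the (standard) solution of the linear heat equation $\overline u_t+\frac12C_1^\#\,\overline u_{\xi\xi}=0$ for $t<T$ with $\overline u(T,\xi)=\frac12|\xi|$, i.e. $\overline u(t,\xi)=\frac12\int_{\mathbb{R}}\big|\xi+\sqrt{C_1^\#(T-t)}\,z\big|\frac{e^{-z^2/2}}{\sqrt{2\pi}}\,dz$. *)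

theory Defs
  imports "HOL-Probability.Probability" "HOL-Real_Asymp.Real_Asymp"
begin

section \<open>The scaled value function\<close>

text \<open>
  The states are the naturals 0 and 1. Experts are functions on \<open>nat\<close>, of which only the values
  at 0 and 1 matter.
\<close>

definition next_state :: "real \<Rightarrow> nat" where
  "next_state b = (if b = 1 then 1 else 0)"

primrec value_steps ::
  "(nat \<Rightarrow> real) \<Rightarrow> (nat \<Rightarrow> real) \<Rightarrow> (real \<Rightarrow> real \<Rightarrow> real) \<Rightarrow> real \<Rightarrow> nat \<Rightarrow> nat \<Rightarrow> real \<Rightarrow> real \<Rightarrow> real"
where
  "value_steps q r \<phi> \<epsilon> 0 m \<xi> \<eta> = \<phi> \<xi> \<eta>"
| "value_steps q r \<phi> \<epsilon> (Suc N) m \<xi> \<eta> =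
     (INF f\<in>{-1..1}. MAX b\<in>{-1, 1}.
        value_steps q r \<phi> \<epsilon> N (next_state b)
          (\<xi> + \<epsilon> * b * (q m - r m)) (\<eta> + \<epsilon> * b * (q m + r m - 2 * f)))"

text \<open>
  The floor only makes the definition total: \<open>u_eps\<close> is meant for times \<open>t \<le> T\<close> at which
  \<open>(T - t) / \<epsilon>\<^sup>2\<close> is a natural number, the number of remaining steps. Lemmas \<open>u_eps_final\<close> and
  \<open>u_eps_dpp\<close> below state the dynamic programming principle in terms of \<open>t\<close>, and that the
  infimum over \<open>f\<close> is a minimum.
\<close>

definition u_eps ::
  "(nat \<Rightarrow> real) \<Rightarrow> (nat \<Rightarrow> real) \<Rightarrow> (real \<Rightarrow> real \<Rightarrow> real) \<Rightarrow> real \<Rightarrow> real \<Rightarrow> real \<Rightarrow> nat \<Rightarrow> real \<Rightarrow> real \<Rightarrow> real"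
where
  "u_eps q r \<phi> \<epsilon> T t m \<xi> \<eta> = value_steps q r \<phi> \<epsilon> (nat \<lfloor>(T - t) / \<epsilon>\<^sup>2\<rfloor>) m \<xi> \<eta>"

definition classic_data :: "real \<Rightarrow> real \<Rightarrow> real" where
  "classic_data \<xi> \<eta> = (\<eta> + \<bar>\<xi>\<bar>) / 2"


section \<open>The final-value problem\<close>

definition C1_sharp :: "(nat \<Rightarrow> real) \<Rightarrow> (nat \<Rightarrow> real) \<Rightarrow> real" where
  "C1_sharp q r = 1/2 * ((q 1 - r 1)\<^sup>2 + (q 0 - r 0)\<^sup>2)"

definition heat_solution :: "real \<Rightarrow> real \<Rightarrow> real \<Rightarrow> real \<Rightarrow> real" where
  "heat_solution c T t \<xi> =
     1/2 * (LINT z|lborel. \<bar>\<xi> + sqrt (c * (T - t)) * z\<bar> * (exp (- (z\<^sup>2) / 2) / sqrt (2 * pi)))"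

text \<open>
  For the classic data, \<open>classic_solution\<close> is what is meant by ``the solution'' of the final-value
  problem \<open>solves_final_value_problem\<close>; see lemma \<open>classic_solution_solves\<close>.
\<close>

definition classic_solution :: "real \<Rightarrow> real \<Rightarrow> real \<Rightarrow> real \<Rightarrow> real \<Rightarrow> real" where
  "classic_solution c T t \<xi> \<eta> = \<eta> / 2 + heat_solution c T t \<xi>"

text \<open>
  Below, \<open>(p\<^sub>1, p\<^sub>2) = (- u\<^sub>\<eta>, u\<^sub>\<xi>) / u\<^sub>\<eta>\<close>, and the bracket is the quadratic form of the Hessian.
\<close>

definition solves_final_value_problem ::
  "real \<Rightarrow> real \<Rightarrow> (real \<Rightarrow> real \<Rightarrow> real) \<Rightarrow> (real \<Rightarrow> real \<Rightarrow> real \<Rightarrow> real) \<Rightarrow> bool"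
where
  "solves_final_value_problem c T \<phi> u \<longleftrightarrow>
     (\<exists>ut ux ue uxx uxe uex uee. \<forall>t<T. \<forall>\<xi> \<eta>.
        ((\<lambda>s. u s \<xi> \<eta>) has_real_derivative ut t \<xi> \<eta>) (at t) \<and>
        ((\<lambda>x. u t x \<eta>) has_real_derivative ux t \<xi> \<eta>) (at \<xi>) \<and>
        ((\<lambda>y. u t \<xi> y) has_real_derivative ue t \<xi> \<eta>) (at \<eta>) \<and>
        ((\<lambda>x. ux t x \<eta>) has_real_derivative uxx t \<xi> \<eta>) (at \<xi>) \<and>
        ((\<lambda>y. ux t \<xi> y) has_real_derivative uxe t \<xi> \<eta>) (at \<eta>) \<and>
        ((\<lambda>x. ue t x \<eta>) has_real_derivative uex t \<xi> \<eta>) (at \<xi>) \<and>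
        ((\<lambda>y. ue t \<xi> y) has_real_derivative uee t \<xi> \<eta>) (at \<eta>) \<and>
        ue t \<xi> \<eta> \<noteq> 0 \<and>
        (let p\<^sub>1 = - ue t \<xi> \<eta> / ue t \<xi> \<eta>; p\<^sub>2 = ux t \<xi> \<eta> / ue t \<xi> \<eta> in
           ut t \<xi> \<eta> + 1/2 * c *
             (uxx t \<xi> \<eta> * p\<^sub>1\<^sup>2 + (uxe t \<xi> \<eta> + uex t \<xi> \<eta>) * p\<^sub>1 * p\<^sub>2 + uee t \<xi> \<eta> * p\<^sub>2\<^sup>2) = 0)) \<and>
     (\<forall>\<xi> \<eta>. u T \<xi> \<eta> = \<phi> \<xi> \<eta>) \<and>
     continuous_on ({..T} \<times> UNIV) (\<lambda>(t, \<xi>, \<eta>). u t \<xi> \<eta>)"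


section \<open>The dynamic programming principle\<close>

lemma Max_pm: "(MAX b\<in>{-1, 1::real}. g b) = max (g (-1)) (g 1 :: real)"
  by simp

lemma INF_diff_le:
  fixes g h :: "real \<Rightarrow> real"
  assumes "A \<noteq> {}" "bdd_below (g ` A)" "\<And>f. f \<in> A \<Longrightarrow> g f \<le> h f + K"
  shows "(INF f\<in>A. g f) \<le> (INF f\<in>A. h f) + K"
proof -
  have "(INF f\<in>A. g f) - K \<le> (INF f\<in>A. h f)"
  proof (rule cINF_greatest[OF assms(1)])
    fix f assume f: "f \<in> A"
    have "(INF f\<in>A. g f) \<le> g f"
      by (rule cINF_lower[OF assms(2) f])
    with assms(3)[OF f] show "(INF f\<in>A. g f) - K \<le> h f" by linarith
  qed
  then show ?thesis by linarith
qed

definition step_max ::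
  "(nat \<Rightarrow> real) \<Rightarrow> (nat \<Rightarrow> real) \<Rightarrow> real \<Rightarrow> (nat \<Rightarrow> real \<Rightarrow> real \<Rightarrow> real) \<Rightarrow> nat \<Rightarrow> real \<Rightarrow> real \<Rightarrow> real \<Rightarrow> real"
where
  "step_max q r \<epsilon> v m \<xi> \<eta> f = (MAX b\<in>{-1, 1}.
     v (next_state b) (\<xi> + \<epsilon> * b * (q m - r m)) (\<eta> + \<epsilon> * b * (q m + r m - 2 * f)))"

lemma step_max_Lipschitz:
  assumes L: "\<And>m \<xi> \<eta> \<xi>' \<eta>'. v m \<xi> \<eta> \<le> v m \<xi>' \<eta>' + (\<bar>\<xi> - \<xi>'\<bar> + \<bar>\<eta> - \<eta>'\<bar>) / 2"
  shows "step_max q r \<epsilon> v m \<xi> \<eta> f \<le> step_max q r \<epsilon> v m \<xi>' \<eta>' f + (\<bar>\<xi> - \<xi>'\<bar> + \<bar>\<eta> - \<eta>'\<bar>) / 2"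
    and "continuous_on {-1..1} (step_max q r \<epsilon> v m \<xi> \<eta>)"
proof -
  have *: "v n (\<xi> + a) (\<eta> + b) \<le> v n (\<xi>' + a) (\<eta>' + b) + (\<bar>\<xi> - \<xi>'\<bar> + \<bar>\<eta> - \<eta>'\<bar>) / 2" for n a b
    using L[of n "\<xi> + a" "\<eta> + b" "\<xi>' + a" "\<eta>' + b"] by simp
  show "step_max q r \<epsilon> v m \<xi> \<eta> f \<le> step_max q r \<epsilon> v m \<xi>' \<eta>' f + (\<bar>\<xi> - \<xi>'\<bar> + \<bar>\<eta> - \<eta>'\<bar>) / 2"
    unfolding step_max_def Max_pm
    using *[of "next_state (-1)" "\<epsilon> * -1 * (q m - r m)" "\<epsilon> * -1 * (q m + r m - 2 * f)"]
      *[of "next_state 1" "\<epsilon> * 1 * (q m - r m)" "\<epsilon> * 1 * (q m + r m - 2 * f)"]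
    by linarith
  have "continuous_on UNIV (\<lambda>\<eta>. v n \<xi> \<eta>)" for n \<xi>
  proof (rule lipschitz_on_continuous_on[of "1/2"], rule lipschitz_onI)
    fix x y
    show "dist (v n \<xi> x) (v n \<xi> y) \<le> 1/2 * dist x y"
      using L[of n \<xi> x \<xi> y] L[of n \<xi> y \<xi> x] unfolding dist_real_def abs_le_iff
      by (simp add: abs_minus_commute[of y x])
  qed simp
  then have c: "continuous_on {-1..1} (\<lambda>f. v n \<xi>' (g f))" if "continuous_on {-1..1} g" for n \<xi>' g
    by (rule continuous_on_compose2[OF _ that]) simp
  then show "continuous_on {-1..1} (step_max q r \<epsilon> v m \<xi> \<eta>)"
    unfolding step_max_def Max_pm by (intro continuous_on_max c continuous_intros)
qed

lemma value_steps_Suc: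
  "value_steps q r \<phi> \<epsilon> (Suc N) m \<xi> \<eta>
    = (INF f\<in>{-1..1}. step_max q r \<epsilon> (value_steps q r \<phi> \<epsilon> N) m \<xi> \<eta> f)"
  by (simp add: step_max_def)

lemma value_steps_Lipschitz:
  "value_steps q r classic_data \<epsilon> N m \<xi> \<eta>
    \<le> value_steps q r classic_data \<epsilon> N m \<xi>' \<eta>' + (\<bar>\<xi> - \<xi>'\<bar> + \<bar>\<eta> - \<eta>'\<bar>) / 2"
proof (induction N arbitrary: m \<xi> \<eta> \<xi>' \<eta>')
  case 0
  show ?case unfolding value_steps.simps classic_data_def by argo
next
  case (Suc N)
  show ?case
    unfolding value_steps_Suc
  proof (rule INF_diff_le)
    show "bdd_below (step_max q r \<epsilon> (value_steps q r classic_data \<epsilon> N) m \<xi> \<eta> ` {-1..1})"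
      by (intro bounded_imp_bdd_below compact_imp_bounded compact_continuous_image
            step_max_Lipschitz(2)[OF Suc.IH]) auto
  qed (auto intro: step_max_Lipschitz(1)[OF Suc.IH])
qed

lemma u_eps_final: "u_eps q r \<phi> \<epsilon> T T m \<xi> \<eta> = \<phi> \<xi> \<eta>"
  by (simp add: u_eps_def)

lemma u_eps_dpp:
  fixes q r \<epsilon> T t m \<xi> \<eta>
  defines "g \<equiv> \<lambda>f. MAX b\<in>{-1, 1}. u_eps q r classic_data \<epsilon> T (t + \<epsilon>\<^sup>2) (next_state b)
                 (\<xi> + \<epsilon> * b * (q m - r m)) (\<eta> + \<epsilon> * b * (q m + r m - 2 * f))"
  assumes "\<epsilon> > 0" "t < T" "(T - t) / \<epsilon>\<^sup>2 \<in> \<nat>"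
  shows "\<exists>f\<in>{-1..1}. u_eps q r classic_data \<epsilon> T t m \<xi> \<eta> = g f \<and> (\<forall>f'\<in>{-1..1}. g f \<le> g f')"
proof -
  obtain N where N: "(T - t) / \<epsilon>\<^sup>2 = real N"
    using assms(4) by (auto elim: Nats_cases)
  have "real N > 0" unfolding N[symmetric] using assms(2,3) by simp
  then have "N \<noteq> 0" by simp
  then obtain N' where N': "N = Suc N'" by (cases N) auto
  have "(T - (t + \<epsilon>\<^sup>2)) / \<epsilon>\<^sup>2 = real N'"
    using N N' assms(2) by (simp add: field_simps)
  then have g: "g = step_max q r \<epsilon> (value_steps q r classic_data \<epsilon> N') m \<xi> \<eta>"
    unfolding g_def step_max_def u_eps_def by simp
  have u: "u_eps q r classic_data \<epsilon> T t m \<xi> \<eta> = (INF f\<in>{-1..1}. g f)"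
    unfolding g u_eps_def N N' value_steps_Suc[symmetric] by (simp del: value_steps.simps of_nat_Suc)
  obtain f where f: "f \<in> {-1..1}" "\<forall>f'\<in>{-1..1}. g f \<le> g f'"
    using continuous_attains_inf[of "{-1..1::real}" g]
      step_max_Lipschitz(2)[of "value_steps q r classic_data \<epsilon> N'", OF value_steps_Lipschitz] g
    by fastforce
  then have "(INF f\<in>{-1..1}. g f) = g f"
    by (intro cInf_eq_minimum) auto
  with f u show ?thesis by auto
qed


section \<open>The classic solution solves the final-value problem\<close>

lemma heat_solution_std_normal:
  "heat_solution c T t \<xi> = 1/2 * (LINT z|lborel. \<bar>\<xi> + sqrt (c * (T - t)) * z\<bar> * std_normal_density z)"
  unfolding heat_solution_def std_normal_density_def by simp

lemma integrable_abs_normal: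
  "integrable lborel (\<lambda>z. \<bar>\<xi> + \<sigma> * z\<bar> * std_normal_density z)"
proof (rule Bochner_Integration.integrable_bound)
  show "integrable lborel (\<lambda>z. \<bar>\<xi>\<bar> * (std_normal_density z * \<bar>z\<bar> ^ 0) + \<bar>\<sigma>\<bar> * (std_normal_density z * \<bar>z\<bar> ^ 1))"
    by (intro Bochner_Integration.integrable_add integrable_mult_right integrable_std_normal_moment_abs)
  show "AE z in lborel. norm (\<bar>\<xi> + \<sigma> * z\<bar> * std_normal_density z)
      \<le> norm (\<bar>\<xi>\<bar> * (std_normal_density z * \<bar>z\<bar> ^ 0) + \<bar>\<sigma>\<bar> * (std_normal_density z * \<bar>z\<bar> ^ 1))"
  proof (rule AE_I2)
    fix z
    have "\<bar>\<xi> + \<sigma> * z\<bar> * std_normal_density z \<le> (\<bar>\<xi>\<bar> + \<bar>\<sigma>\<bar> * \<bar>z\<bar>) * std_normal_density z"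
      by (intro mult_right_mono) (auto simp: abs_mult[symmetric])
    then show "norm (\<bar>\<xi> + \<sigma> * z\<bar> * std_normal_density z)
      \<le> norm (\<bar>\<xi>\<bar> * (std_normal_density z * \<bar>z\<bar> ^ 0) + \<bar>\<sigma>\<bar> * (std_normal_density z * \<bar>z\<bar> ^ 1))"
      by (simp add: abs_mult algebra_simps)
  qed
qed simp

lemma DERIV_std_normal_density [derivative_intros]:
  assumes "(g has_real_derivative g') (at x)"
  shows "((\<lambda>x. std_normal_density (g x)) has_real_derivative - g x * std_normal_density (g x) * g') (at x)"
  unfolding std_normal_density_def
  by (rule derivative_eq_intros assms refl | simp)+

lemma std_normal_density_minus: "std_normal_density (- x) = std_normal_density x"
  by (simp add: std_normal_density_def)

lemma isCont_std_normal_density [continuous_intros]: "isCont std_normal_density x"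
  by (rule DERIV_isCont[OF DERIV_std_normal_density[OF DERIV_ident]])

lemma std_normal_density_lim: "(std_normal_density \<longlongrightarrow> 0) at_top" "(std_normal_density \<longlongrightarrow> 0) at_bot"
proof -
  have "((\<lambda>x. 1 / sqrt (2 * pi) * exp (- (x\<^sup>2) / 2)) \<longlongrightarrow> 1 / sqrt (2 * pi) * 0) F"
    if "filterlim (\<lambda>x::real. - (x\<^sup>2) / 2) at_bot F" for F
    by (intro tendsto_mult tendsto_const filterlim_compose[OF exp_at_bot that])
  moreover have "filterlim (\<lambda>x::real. - (x\<^sup>2) / 2) at_bot at_top" "filterlim (\<lambda>x::real. - (x\<^sup>2) / 2) at_bot at_bot"
    by real_asymp+
  ultimately show "(std_normal_density \<longlongrightarrow> 0) at_top" "(std_normal_density \<longlongrightarrow> 0) at_bot"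
    unfolding std_normal_density_def by fastforce+
qed

text \<open>The odd antiderivative of the standard normal density.\<close>

lemma std_normal_antiderivative:
  obtains H :: "real \<Rightarrow> real" where
    "\<And>x. (H has_real_derivative std_normal_density x) (at x)"
    "(H \<longlongrightarrow> 1/2) at_top" "(H \<longlongrightarrow> - (1/2)) at_bot"
proof -
  define K where "K x = (LINT y|lborel. indicator {..x} y *\<^sub>R std_normal_density y)" for x :: real
  have int: "integrable lborel std_normal_density"
    using integrable_std_normal_moment[of 0] by simp
  have one: "(LINT y|lborel. std_normal_density y) = 1"
    using integral_std_normal_moment_even[of 0] by simp
  have top: "(K \<longlongrightarrow> 1) at_top"
    unfolding K_def using tendsto_integral_at_top[OF _ int] one by simp
  have inti: "integrable lborel (\<lambda>y. indicator A y *\<^sub>R std_normal_density y)"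
    if "A \<in> sets borel" for A
    using integrable_mult_indicator[OF _ int, of A] that by simp
  have mirror: "K (- x) = 1 - K x" for x
  proof -
    have "K (- x) = (LINT y|lborel. indicator {..-x} (-y) *\<^sub>R std_normal_density (-y))"
      unfolding K_def using lborel_integral_real_affine[of "-1" "\<lambda>y. indicator {..-x} y *\<^sub>R std_normal_density y" 0]
      by simp
    also have "\<dots> = (LINT y|lborel. std_normal_density y - indicator {..x} y *\<^sub>R std_normal_density y)"
    proof (rule integral_cong_AE)
      have "AE y in lborel. y \<noteq> x" by (rule AE_lborel_singleton)
      then show "AE y in lborel. indicator {..-x} (-y) *\<^sub>R std_normal_density (-y)
          = std_normal_density y - indicator {..x} y *\<^sub>R std_normal_density y"
        by eventually_elim (auto simp: std_normal_density_minus indicator_def)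
    qed auto
    also have "\<dots> = 1 - K x"
      unfolding K_def by (subst Bochner_Integration.integral_diff) (use int inti one in auto)
    finally show ?thesis .
  qed
  have bot: "(K \<longlongrightarrow> 0) at_bot"
  proof -
    have "((\<lambda>x. 1 - K x) \<longlongrightarrow> 1 - 1) at_top"
      by (intro tendsto_intros top)
    then have "((\<lambda>x. K (- x)) \<longlongrightarrow> 0) at_top" by (simp add: mirror)
    then show ?thesis by (simp add: filterlim_at_bot_mirror)
  qed
  have der: "(K has_real_derivative std_normal_density x) (at x)" for x
  proof -
    let ?a = "x - 1" and ?b = "x + 1"
    have cont: "continuous_on S std_normal_density" for S
      by (intro continuous_at_imp_continuous_on ballI isCont_std_normal_density)
    have eq: "K y = K ?a + integral {?a..y} std_normal_density" if "y \<in> {?a..?b}" for y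
    proof -
      have "K y = (LINT z|lborel. indicator {..?a} z *\<^sub>R std_normal_density z
                 + indicator {?a..y} z *\<^sub>R std_normal_density z)"
        unfolding K_def
      proof (rule integral_cong_AE)
        have "AE z in lborel. z \<noteq> ?a" by (rule AE_lborel_singleton)
        then show "AE z in lborel. indicator {..y} z *\<^sub>R std_normal_density z =
            indicator {..?a} z *\<^sub>R std_normal_density z + indicator {?a..y} z *\<^sub>R std_normal_density z"
          by eventually_elim (use that in \<open>auto simp: indicator_def\<close>)
      qed auto
      also have "\<dots> = K ?a + (LINT z:{?a..y}|lborel. std_normal_density z)"
        unfolding K_def set_lebesgue_integral_def
        by (subst Bochner_Integration.integral_add) (use inti in auto)
      also have "(LINT z:{?a..y}|lborel. std_normal_density z) = integral {?a..y} std_normal_density"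
        by (rule set_borel_integral_eq_integral) (use inti[of "{?a..y}"] in \<open>simp add: set_integrable_def\<close>)
      finally show ?thesis .
    qed
    have "((\<lambda>y. integral {?a..y} std_normal_density) has_real_derivative std_normal_density x)
            (at x within {?a..?b})"
      by (rule integral_has_real_derivative[OF cont]) simp
    then have "((\<lambda>y. K ?a + integral {?a..y} std_normal_density) has_real_derivative std_normal_density x)
            (at x within {?a..?b})"
      by (auto intro!: derivative_eq_intros)
    then have "((\<lambda>y. K ?a + integral {?a..y} std_normal_density) has_real_derivative std_normal_density x) (at x)"
      by (simp add: at_within_Icc_at)
    moreover have "eventually (\<lambda>y. K ?a + integral {?a..y} std_normal_density = K y) (nhds x)"
      proof (rule eventually_mono)
      show "eventually (\<lambda>y. y \<in> {?a<..<?b}) (nhds x)"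
        by (rule eventually_nhds_in_open) auto
    qed (rule eq[symmetric], simp)
    ultimately show ?thesis
      by (subst (asm) DERIV_cong_ev[OF refl _ refl]) 
  qed
  show thesis
  proof (rule that[of "\<lambda>x. K x - 1/2"])
    show "((\<lambda>x. K x - 1/2) has_real_derivative std_normal_density x) (at x)" for x
      by (auto intro!: derivative_eq_intros der)
    show "((\<lambda>x. K x - 1/2) \<longlongrightarrow> 1/2) at_top"
      using tendsto_diff[OF top tendsto_const[of "1/2"]] by simp
    show "((\<lambda>x. K x - 1/2) \<longlongrightarrow> - (1/2)) at_bot"
      using tendsto_diff[OF bot tendsto_const[of "1/2"]] by simp
  qed
qed

lemma integral_abs_normal:
  assumes H: "\<And>x. (H has_real_derivative std_normal_density x) (at x)"
    "(H \<longlongrightarrow> 1/2) at_top" "(H \<longlongrightarrow> - (1/2)) at_bot"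
    and "\<sigma> > 0"
  shows "(LINT z|lborel. \<bar>\<xi> + \<sigma> * z\<bar> * std_normal_density z)
    = 2 * \<sigma> * std_normal_density (\<xi> / \<sigma>) - 2 * \<xi> * H (- \<xi> / \<sigma>)"
proof -
  define P where "P z = \<xi> * H z - \<sigma> * std_normal_density z" for z
  define z0 where "z0 = - \<xi> / \<sigma>"
  define F where "F z = (if z \<le> z0 then P z0 - P z else P z - P z0)" for z
  let ?f = "\<lambda>z. \<bar>\<xi> + \<sigma> * z\<bar> * std_normal_density z"
  have P: "(P has_real_derivative (\<xi> + \<sigma> * z) * std_normal_density z) (at z within S)" for z S
    unfolding P_def by (rule has_field_derivative_at_within, (rule derivative_eq_intros H refl)+)
      (simp add: algebra_simps)
  have sgn: "\<xi> + \<sigma> * z \<le> 0 \<longleftrightarrow> z \<le> z0" for z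
    using \<open>\<sigma> > 0\<close> by (auto simp: z0_def field_simps)
  have "\<xi> + \<sigma> * z0 = 0" using \<open>\<sigma> > 0\<close> by (simp add: z0_def)
  have F: "(F has_real_derivative ?f z) (at z)" for z
  proof -
    have "((\<lambda>z. if z \<in> {..z0} then P z0 - P z else P z - P z0) has_vector_derivative
       (if z \<in> {..z0} then - ((\<xi> + \<sigma> * z) * std_normal_density z) else (\<xi> + \<sigma> * z) * std_normal_density z))
       (at z within UNIV)"
    proof (rule has_vector_derivative_If_within_closures[where T = "{z0..}"])
      show "((\<lambda>z. P z0 - P z) has_vector_derivative - ((\<xi> + \<sigma> * z) * std_normal_density z))
         (at z within {..z0} \<union> closure {..z0} \<inter> closure {z0..})"
        unfolding has_real_derivative_iff_has_vector_derivative[symmetric]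
        by (auto intro!: derivative_eq_intros P)
      show "((\<lambda>z. P z - P z0) has_vector_derivative (\<xi> + \<sigma> * z) * std_normal_density z)
         (at z within {z0..} \<union> closure {..z0} \<inter> closure {z0..})"
        unfolding has_real_derivative_iff_has_vector_derivative[symmetric]
        by (auto intro!: derivative_eq_intros P)
    qed (use \<open>\<xi> + \<sigma> * z0 = 0\<close> in auto)
    moreover have "(if z \<in> {..z0} then - ((\<xi> + \<sigma> * z) * std_normal_density z)
        else (\<xi> + \<sigma> * z) * std_normal_density z) = ?f z"
      using sgn[of z] by (auto simp: algebra_simps)
    ultimately show ?thesis
      unfolding F_def has_real_derivative_iff_has_vector_derivative by simp
  qed
  have top: "(F \<longlongrightarrow> \<xi> * (1/2) - \<sigma> * 0 - P z0) at_top"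
  proof (rule Lim_transform_eventually)
    show "((\<lambda>z. P z - P z0) \<longlongrightarrow> \<xi> * (1/2) - \<sigma> * 0 - P z0) at_top"
      unfolding P_def by (intro tendsto_intros H std_normal_density_lim)
    show "eventually (\<lambda>z. P z - P z0 = F z) at_top"
      using eventually_gt_at_top[of z0] by eventually_elim (simp add: F_def)
  qed
  have bot: "(F \<longlongrightarrow> P z0 - (\<xi> * (- (1/2)) - \<sigma> * 0)) at_bot"
  proof (rule Lim_transform_eventually)
    show "((\<lambda>z. P z0 - P z) \<longlongrightarrow> P z0 - (\<xi> * (- (1/2)) - \<sigma> * 0)) at_bot"
      unfolding P_def by (intro tendsto_intros H std_normal_density_lim)
    show "eventually (\<lambda>z. P z0 - P z = F z) at_bot"
      using eventually_le_at_bot[of z0] by eventually_elim (simp add: F_def)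
  qed
  have "(LBINT z=-\<infinity>..\<infinity>. ?f z) = (\<xi> * (1/2) - \<sigma> * 0 - P z0) - (P z0 - (\<xi> * (- (1/2)) - \<sigma> * 0))"
    by (rule interval_integral_FTC_nonneg[where F = F])
      (use F top bot in \<open>auto simp: ereal_tendsto_simps intro!: continuous_intros isCont_std_normal_density\<close>)
  then have "(LINT z|lborel. ?f z) = - 2 * P z0"
    by (simp add: interval_lebesgue_integral_def set_lebesgue_integral_def)
  also have "P z0 = \<xi> * H (- \<xi> / \<sigma>) - \<sigma> * std_normal_density (\<xi> / \<sigma>)"
    using std_normal_density_minus[of "\<xi> / \<sigma>"] by (simp add: P_def z0_def)
  finally show ?thesis by (simp add: algebra_simps)
qed

lemma heat_solution_Lipschitz:
  "\<bar>heat_solution c T t \<xi> - heat_solution c T s x\<bar>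
    \<le> \<bar>\<xi> - x\<bar> + \<bar>sqrt (c * (T - t)) - sqrt (c * (T - s))\<bar>"
proof -
  define a b where "a = sqrt (c * (T - t))" and "b = sqrt (c * (T - s))"
  let ?I = "\<lambda>\<xi> a. LINT z|lborel. \<bar>\<xi> + a * z\<bar> * std_normal_density z"
  have "\<bar>?I \<xi> a - ?I x b\<bar>
      = \<bar>LINT z|lborel. \<bar>\<xi> + a * z\<bar> * std_normal_density z - \<bar>x + b * z\<bar> * std_normal_density z\<bar>"
    by (subst Bochner_Integration.integral_diff) (auto intro: integrable_abs_normal)
  also have "\<dots> \<le> (LINT z|lborel. \<bar>\<xi> - x\<bar> * (std_normal_density z * z ^ (2 * 0))
      + \<bar>a - b\<bar> * (std_normal_density z * \<bar>z\<bar> ^ (2 * 0 + 1)))"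
  proof (rule integral_abs_bound_integral)
    show "integrable lborel (\<lambda>z. \<bar>\<xi> + a * z\<bar> * std_normal_density z - \<bar>x + b * z\<bar> * std_normal_density z)"
      by (intro Bochner_Integration.integrable_diff integrable_abs_normal)
    show "integrable lborel (\<lambda>z. \<bar>\<xi> - x\<bar> * (std_normal_density z * z ^ (2 * 0))
      + \<bar>a - b\<bar> * (std_normal_density z * \<bar>z\<bar> ^ (2 * 0 + 1)))"
      by (intro Bochner_Integration.integrable_add integrable_mult_right
          integrable_std_normal_moment_abs integrable_std_normal_moment)
    fix z
    have "\<bar>a * z - b * z\<bar> = \<bar>a - b\<bar> * \<bar>z\<bar>"
      by (simp add: abs_mult[symmetric] left_diff_distrib)
    then have "\<bar>\<bar>\<xi> + a * z\<bar> - \<bar>x + b * z\<bar>\<bar> \<le> \<bar>\<xi> - x\<bar> + \<bar>a - b\<bar> * \<bar>z\<bar>"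
      by linarith
    then have "\<bar>\<bar>\<xi> + a * z\<bar> - \<bar>x + b * z\<bar>\<bar> * std_normal_density z
        \<le> (\<bar>\<xi> - x\<bar> + \<bar>a - b\<bar> * \<bar>z\<bar>) * std_normal_density z"
      by (rule mult_right_mono) simp
    then show "\<bar>\<bar>\<xi> + a * z\<bar> * std_normal_density z - \<bar>x + b * z\<bar> * std_normal_density z\<bar>
      \<le> \<bar>\<xi> - x\<bar> * (std_normal_density z * z ^ (2 * 0))
        + \<bar>a - b\<bar> * (std_normal_density z * \<bar>z\<bar> ^ (2 * 0 + 1))"
      by (simp only: left_diff_distrib[symmetric] abs_mult[of _ "std_normal_density z"])
        (simp add: algebra_simps)
  qed
  also have "\<dots> = \<bar>\<xi> - x\<bar> * 1 + \<bar>a - b\<bar> * sqrt (2 / pi)"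
    using integral_std_normal_moment_even[of 0] integral_std_normal_moment_abs_odd[of 0]
      integrable_std_normal_moment[of 0] integrable_std_normal_moment_abs[of 1]
    by (subst Bochner_Integration.integral_add) auto
  also have "\<dots> \<le> \<bar>\<xi> - x\<bar> * 2 + \<bar>a - b\<bar> * 2"
  proof (intro add_mono mult_left_mono)
    show "sqrt (2 / pi) \<le> 2"
      using pi_gt3 by (intro real_le_lsqrt) (auto simp: field_simps)
  qed auto
  finally have "\<bar>?I \<xi> a - ?I x b\<bar> \<le> \<bar>\<xi> - x\<bar> * 2 + \<bar>a - b\<bar> * 2" .
  moreover have "\<bar>1/2 * i - 1/2 * j\<bar> \<le> k + l" if "\<bar>i - j\<bar> \<le> k * 2 + l * 2" for i j k l :: real
    using that by (simp add: abs_le_iff)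
  ultimately show ?thesis
    unfolding heat_solution_std_normal a_def b_def by blast
qed

lemma classic_solution_solves:
  assumes "c > 0"
  shows "solves_final_value_problem c T classic_data (classic_solution c T)"
proof -
  obtain H where H: "\<And>x. (H has_real_derivative std_normal_density x) (at x)"
    "(H \<longlongrightarrow> 1/2) at_top" "(H \<longlongrightarrow> - (1/2)) at_bot"
    using std_normal_antiderivative by blast
  define \<sigma> where "\<sigma> t = sqrt (c * (T - t))" for t
  have \<sigma>: "\<sigma> t > 0" if "t < T" for t
    using that assms by (simp add: \<sigma>_def)
  have d\<sigma>: "(\<sigma> has_real_derivative - c / (2 * \<sigma> t)) (at t within S)" if "t < T" for t S
    unfolding \<sigma>_def using that assms
    by (auto intro!: derivative_eq_intros simp: field_simps)
  let ?G = "\<lambda>\<sigma> x. \<sigma> * std_normal_density (x / \<sigma>) - x * H (- x / \<sigma>)"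
  have u: "classic_solution c T t x y = y / 2 + ?G (\<sigma> t) x" if "t < T" for t x y
    using integral_abs_normal[OF H \<sigma>[OF that], of x]
    unfolding classic_solution_def heat_solution_std_normal \<sigma>_def by simp
  note [derivative_intros] = DERIV_chain2[OF H(1)]
  define ut where "ut t x (y::real) = - (1/2) * c * std_normal_density (x / \<sigma> t) / \<sigma> t" for t x y
  define ux where "ux t x (y::real) = - H (- x / \<sigma> t)" for t x y
  define ue where "ue t x y = (1/2::real)" for t x y :: real
  define uxx where "uxx t x (y::real) = std_normal_density (x / \<sigma> t) / \<sigma> t" for t x y
  define z where "z t x y = (0::real)" for t x y :: real
  have minus: "std_normal_density (- x / a) = std_normal_density (x / a)"
      "std_normal_density (- (x / a)) = std_normal_density (x / a)" for x a
    using std_normal_density_minus[of "x / a"] by simp_all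
  have sp: "\<sigma> t \<noteq> 0" if "t < T" for t using \<sigma>[OF that] by simp
  have pde: "((\<lambda>s. classic_solution c T s x y) has_real_derivative ut t x y) (at t) \<and>
        ((\<lambda>x. classic_solution c T t x y) has_real_derivative ux t x y) (at x) \<and>
        ((\<lambda>y. classic_solution c T t x y) has_real_derivative ue t x y) (at y) \<and>
        ((\<lambda>x. ux t x y) has_real_derivative uxx t x y) (at x) \<and>
        ((\<lambda>y. ux t x y) has_real_derivative z t x y) (at y) \<and>
        ((\<lambda>x. ue t x y) has_real_derivative z t x y) (at x) \<and>
        ((\<lambda>y. ue t x y) has_real_derivative z t x y) (at y) \<and>
        ue t x y \<noteq> 0 \<and>
        (let p1 = - ue t x y / ue t x y; p2 = ux t x y / ue t x y in
           ut t x y + 1/2 * c * (uxx t x y * p1\<^sup>2 + (z t x y + z t x y) * p1 * p2 + z t x y * p2\<^sup>2) = 0)"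
    if t: "t < T" for t x y
  proof (intro conjI)
    have "((\<lambda>s. y / 2 + ?G (\<sigma> s) x) has_real_derivative ut t x y) (at t)"
      unfolding ut_def using sp[OF t]
      by (auto intro!: derivative_eq_intros d\<sigma> t simp: minus field_simps power2_eq_square)
    moreover have "eventually (\<lambda>s. y / 2 + ?G (\<sigma> s) x = classic_solution c T s x y) (nhds t)"
      using eventually_nhds_in_open[of "{..<T}" t] t
      by (auto elim!: eventually_mono simp: u)
    ultimately show "((\<lambda>s. classic_solution c T s x y) has_real_derivative ut t x y) (at t)"
      by (subst (asm) DERIV_cong_ev[OF refl _ refl])
    show "((\<lambda>x. classic_solution c T t x y) has_real_derivative ux t x y) (at x)"
      unfolding u[OF t] ux_def using sp[OF t]
      by (auto intro!: derivative_eq_intros simp: minus field_simps)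
    show "((\<lambda>y. classic_solution c T t x y) has_real_derivative ue t x y) (at y)"
      unfolding u[OF t] ue_def by (auto intro!: derivative_eq_intros)
    show "((\<lambda>x. ux t x y) has_real_derivative uxx t x y) (at x)"
      unfolding ux_def uxx_def using sp[OF t]
      by (auto intro!: derivative_eq_intros simp: minus field_simps)
  qed (auto simp: ux_def ue_def z_def ut_def uxx_def Let_def)
  have "heat_solution c T T x = \<bar>x\<bar> / 2" for x
    using integral_std_normal_moment_even[of 0] by (simp add: heat_solution_std_normal)
  then have fin: "classic_solution c T T x y = classic_data x y" for x y
    by (simp add: classic_solution_def classic_data_def field_simps)
  have "continuous_on ({..T} \<times> UNIV) (\<lambda>p. heat_solution c T (fst p) (snd p))"
    unfolding continuous_on_def
  proof
    fix p0 :: "real \<times> real"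
    have "((\<lambda>p. heat_solution c T (fst p) (snd p) - heat_solution c T (fst p0) (snd p0)) \<longlongrightarrow> 0)
      (at p0 within {..T} \<times> UNIV)"
    proof (rule tendsto_rabs_zero_cancel, rule tendsto_sandwich[OF _ _ tendsto_const])
      show "((\<lambda>p. \<bar>snd p - snd p0\<bar> + \<bar>sqrt (c * (T - fst p)) - sqrt (c * (T - fst p0))\<bar>) \<longlongrightarrow> 0)
        (at p0 within {..T} \<times> UNIV)"
        by (auto intro!: tendsto_eq_intros)
    qed (simp_all add: heat_solution_Lipschitz)
    then show "((\<lambda>p. heat_solution c T (fst p) (snd p)) \<longlongrightarrow> heat_solution c T (fst p0) (snd p0))
      (at p0 within {..T} \<times> UNIV)"
      by (rule LIM_zero_cancel)
  qed
  moreover have "continuous_on ({..T} \<times> UNIV) (\<lambda>p::real \<times> real \<times> real. (fst p, fst (snd p)))"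
    by (intro continuous_intros)
  ultimately have "continuous_on ({..T} \<times> UNIV)
      (\<lambda>p::real \<times> real \<times> real. heat_solution c T (fst (fst p, fst (snd p))) (snd (fst p, fst (snd p))))"
    by (rule continuous_on_compose2) auto
  then have "continuous_on ({..T} \<times> UNIV) (\<lambda>(t, x, y). classic_solution c T t x y)"
    unfolding classic_solution_def case_prod_unfold fst_conv snd_conv by (intro continuous_intros) auto
  then show ?thesis
    unfolding solves_final_value_problem_def
    apply (intro conjI)
      apply (rule exI[of _ ut], rule exI[of _ ux], rule exI[of _ ue], rule exI[of _ uxx],
        rule exI[of _ z], rule exI[of _ z], rule exI[of _ z])
      apply (intro allI impI)
      apply (rule pde, assumption)
     apply (intro allI, rule fin)
    apply assumption
    done
qed

end

theory Submission
  imports Defs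
begin

text \<open>
  The data are \<open>\<eta>/2\<close> plus a function of \<open>\<xi>\<close>, and this form persists: the value after \<open>N\<close> steps is
  \<open>\<eta>/2 + \<epsilon> w\<^sub>N(m, \<xi>/\<epsilon>)\<close>. In one step the two moves \<open>b = \<plusminus>1\<close> give values that depend on \<open>f\<close> with opposite
  slopes, so the optimal \<open>f\<close> equalizes them and
  \<open>w\<^sub>N\<^sub>+\<^sub>1(m, x) = (w\<^sub>N(1, x + d m) + w\<^sub>N(0, x - d m))/2\<close> with \<open>d = q - r\<close>, as long as that \<open>f\<close> is in \<open>[-1, 1]\<close>.
  This is the evolution of a correlated random walk whose variance per step is \<open>C1_sharp q r\<close> on
  average; hence the heat equation.

  For the rate, the heat solution \<open>h\<close> (with the accumulated variance \<open>v\<close> as time) is corrected so that it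
  solves the discrete equation up to \<open>O(v\<^sup>-\<^sup>3\<^sup>/\<^sup>2)\<close>: two correctors account for the dependence of the
  increments on the state, and an Edgeworth term of the form \<open>v h\<^sub>x\<^sub>x\<^sub>x\<close> accounts for the skewness of the
  walk. All corrections are bounded (\<open>corrected_heat_near_heat\<close>), and the one-step errors
  (\<open>corrected_heat_one_step\<close>) are summable, so adding or subtracting \<open>B - L/\<surd>v\<close> makes the corrected
  solution a super- or subsolution.

  The subsolution bounds \<open>w\<close> from below for every choice of \<open>f\<close> (\<open>value_steps_ge\<close>). For the supersolution
  the equalizing \<open>f\<close> must be admissible (\<open>value_steps_le\<close>). Since \<open>h\<close> has Lipschitz constant \<open>1/2\<close>, this \<open>f\<close>
  is at most \<open>(\<bar>q + r\<bar> + \<bar>q - r\<bar>)/2 = max \<bar>q\<bar> \<bar>r\<bar> < 1\<close> in absolute value, up to \<open>O(1/\<surd>v)\<close>. Starting the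
  barriers at a large fixed variance \<open>v0\<close> therefore makes it admissible at every step. The same
  shift avoids the kink of the data, at the price of a constant. On the unit scale the
  difference between \<open>w\<^sub>N\<close> and \<open>h\<close> is thus bounded uniformly in \<open>N\<close>, and scaling back gives an error \<open>C\<epsilon>\<close>,
  which is at most \<open>C\<epsilon>\<bar>ln \<epsilon>\<bar>\<close> for small \<open>\<epsilon>\<close>.
\<close>

section \<open>Derivatives of the heat solution\<close>

text \<open>
  The derivatives of the standard normal density, by the three-term recurrence of the Hermite
  polynomials. The recurrence is also what turns a derivative in the variance into two
  derivatives in space.
\<close>

fun gauss_deriv :: "nat \<Rightarrow> real \<Rightarrow> real" where
  "gauss_deriv 0 z = std_normal_density z"
| "gauss_deriv (Suc 0) z = - z * std_normal_density z"
| "gauss_deriv (Suc (Suc n)) z = - z * gauss_deriv (Suc n) z - real (Suc n) * gauss_deriv n z"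

lemma DERIV_gauss_deriv:
  "(gauss_deriv n has_real_derivative gauss_deriv (Suc n) z) (at z)"
proof (induction n arbitrary: z rule: less_induct)
  case (less n)
  consider "n = 0" | "n = 1" | k where "n = Suc (Suc k)"
    by (metis One_nat_def not0_implies_Suc)
  then show ?case
  proof cases
    case 1
    have "gauss_deriv 0 = std_normal_density" by (rule ext) simp
    with 1 show ?thesis
      using DERIV_std_normal_density[OF DERIV_ident, of z] by simp
  next
    case 2
    have "((\<lambda>z. - z * std_normal_density z) has_real_derivative gauss_deriv 2 z) (at z)"
      by (auto intro!: derivative_eq_intros simp: numeral_2_eq_2 algebra_simps)
    then show ?thesis using 2 by (simp add: numeral_2_eq_2)
  next
    case 3
    have "((\<lambda>z. - z * gauss_deriv (Suc k) z - real (Suc k) * gauss_deriv k z)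
        has_real_derivative gauss_deriv (Suc (Suc (Suc k))) z) (at z)"
      by (rule derivative_eq_intros less.IH refl | simp add: 3)+ (simp add: algebra_simps)
    then show ?thesis using 3 by simp
  qed
qed

text \<open>
  The power of \<open>\<bar>z\<bar>\<close> is there for the induction: each step of the recurrence costs one factor \<open>z\<close>.
\<close>

lemma gauss_deriv_moment_bounded: "\<exists>K. \<forall>z. \<bar>z\<bar> ^ k * \<bar>gauss_deriv n z\<bar> \<le> K"
proof (induction n arbitrary: k rule: less_induct)
  case (less n)
  have base: "\<exists>K. \<forall>z. \<bar>z\<bar> ^ k * std_normal_density z \<le> K" for k
  proof (cases "k = 0")
    case True
    have "std_normal_density z \<le> 1 / sqrt (2 * pi)" for z
      by (simp add: std_normal_density_def divide_right_mono)
    with True show ?thesis by auto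
  next
    case False
    have "\<bar>z\<bar> ^ k * std_normal_density z \<le> (2 * real k) ^ k * (1 / sqrt (2 * pi))" for z
    proof -
      \<comment> \<open>\<open>\<bar>z\<bar>\<^sup>k\<close> is dominated by a multiple of \<open>(1 + (z\<^sup>2/2)/k)\<^sup>k \<le> exp (z\<^sup>2/2)\<close>\<close>
      have "\<bar>z\<bar> \<le> 1 + z\<^sup>2"
        using sum_squares_bound[of "\<bar>z\<bar>" 1] by simp
      also have "\<dots> \<le> 2 * real k * (1 + (z\<^sup>2 / 2) / real k)"
        using False by (simp add: field_simps)
      finally have le: "\<bar>z\<bar> ^ k \<le> (2 * real k) ^ k * (1 + (z\<^sup>2 / 2) / real k) ^ k"
        using power_mono[of "\<bar>z\<bar>" "2 * real k * (1 + (z\<^sup>2 / 2) / real k)" k]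
        by (simp only: power_mult_distrib abs_ge_zero)
      have "(1 + (z\<^sup>2 / 2) / real k) ^ k \<le> exp (z\<^sup>2 / 2)"
      proof (rule exp_ge_one_plus_x_over_n_power_n)
        have "0 \<le> z\<^sup>2 / 2" by simp
        then show "- real k \<le> z\<^sup>2 / 2" by linarith
      qed (use False in simp)
      from order_trans[OF le mult_left_mono[OF this]]
      have "\<bar>z\<bar> ^ k \<le> (2 * real k) ^ k * exp (z\<^sup>2 / 2)" by simp
      then have "\<bar>z\<bar> ^ k * std_normal_density z
          \<le> ((2 * real k) ^ k * exp (z\<^sup>2 / 2)) * std_normal_density z"
        by (intro mult_right_mono) auto
      also have "\<dots> = (2 * real k) ^ k * ((exp (z\<^sup>2 / 2) * exp (- z\<^sup>2 / 2)) * (1 / sqrt (2 * pi)))"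
        by (simp add: std_normal_density_def)
      also have "exp (z\<^sup>2 / 2) * exp (- z\<^sup>2 / 2) = 1"
        by (simp add: exp_add[symmetric])
      finally show ?thesis by simp
    qed
    then show ?thesis by blast
  qed
  consider "n = 0" | "n = 1" | j where "n = Suc (Suc j)"
    by (metis One_nat_def not0_implies_Suc)
  then show ?case
  proof cases
    case 1
    with base[of k] show ?thesis by simp
  next
    case 2
    with base[of "Suc k"] show ?thesis by (simp add: abs_mult mult_ac)
  next
    case 3
    obtain K1 where K1: "\<bar>z\<bar> ^ Suc k * \<bar>gauss_deriv (Suc j) z\<bar> \<le> K1" for z
      using less.IH[of "Suc j" "Suc k"] 3 by auto
    obtain K2 where K2: "\<bar>z\<bar> ^ k * \<bar>gauss_deriv j z\<bar> \<le> K2" for z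
      using less.IH[of j k] 3 by auto
    have "\<bar>z\<bar> ^ k * \<bar>gauss_deriv n z\<bar> \<le> K1 + real (Suc j) * K2" for z
    proof -
      have "\<bar>gauss_deriv n z\<bar> \<le> \<bar>z\<bar> * \<bar>gauss_deriv (Suc j) z\<bar> + real (Suc j) * \<bar>gauss_deriv j z\<bar>"
        unfolding 3 gauss_deriv.simps
        by (rule order_trans[OF abs_triangle_ineq4]) (simp add: abs_mult)
      then have "\<bar>z\<bar> ^ k * \<bar>gauss_deriv n z\<bar>
          \<le> \<bar>z\<bar> ^ k * (\<bar>z\<bar> * \<bar>gauss_deriv (Suc j) z\<bar> + real (Suc j) * \<bar>gauss_deriv j z\<bar>)"
        by (rule mult_left_mono) simp
      also have "\<dots> = \<bar>z\<bar> ^ Suc k * \<bar>gauss_deriv (Suc j) z\<bar>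
          + real (Suc j) * (\<bar>z\<bar> ^ k * \<bar>gauss_deriv j z\<bar>)"
        by (simp add: algebra_simps)
      also have "\<dots> \<le> K1 + real (Suc j) * K2"
        by (intro add_mono K1 mult_left_mono K2) auto
      finally show ?thesis .
    qed
    then show ?thesis by blast
  qed
qed

text \<open>
  The spatial derivatives of the heat solution, with the variance \<open>v\<close> (that is, \<open>c (T - t)\<close>) as the
  time variable, so that the heat equation reads \<open>h\<^sub>v = h\<^sub>x\<^sub>x / 2\<close> and \<open>h = \<bar>x\<bar>/2\<close> at \<open>v = 0\<close>.
\<close>

fun heat_deriv :: "nat \<Rightarrow> real \<Rightarrow> real \<Rightarrow> real" where
  "heat_deriv 0 v x = heat_solution 1 v 0 x"
| "heat_deriv (Suc 0) v x = deriv (heat_solution 1 v 0) x"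
| "heat_deriv (Suc (Suc n)) v x = gauss_deriv n (x / sqrt v) / sqrt v ^ Suc n"

text \<open>
  The bound on \<open>H\<close> is what becomes the Lipschitz constant \<open>1/2\<close> of the heat solution. It comes from
  monotonicity and the limits \<open>\<plusminus>1/2\<close> at infinity.
\<close>

lemma heat_solution_closed_form:
  obtains H :: "real \<Rightarrow> real" where
    "\<And>x. (H has_real_derivative std_normal_density x) (at x)"
    "\<And>x. \<bar>H x\<bar> \<le> 1/2"
    "\<And>v x. v > 0 \<Longrightarrow>
       heat_solution 1 v 0 x = sqrt v * std_normal_density (x / sqrt v) - x * H (- x / sqrt v)"
proof -
  obtain H where H: "\<And>x. (H has_real_derivative std_normal_density x) (at x)"
    "(H \<longlongrightarrow> 1/2) at_top" "(H \<longlongrightarrow> - (1/2)) at_bot"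
    using std_normal_antiderivative by blast
  have mono: "H x \<le> H y" if "x \<le> y" for x y
    using DERIV_nonneg_imp_nondecreasing[OF that, of H] H(1) normal_density_nonneg by blast
  have "H x \<le> 1/2" for x
    by (rule tendsto_lowerbound[OF H(2)])
      (auto intro: eventually_mono[OF eventually_ge_at_top[of x]] mono)
  moreover have "- (1/2) \<le> H x" for x
    by (rule tendsto_upperbound[OF H(3)])
      (auto intro: eventually_mono[OF eventually_le_at_bot[of x]] mono)
  ultimately have "\<bar>H x\<bar> \<le> 1/2" for x
    by (meson abs_le_iff minus_le_iff)
  moreover have "heat_solution 1 v 0 x = sqrt v * std_normal_density (x / sqrt v) - x * H (- x / sqrt v)"
    if "v > 0" for v x
    unfolding heat_solution_std_normal using integral_abs_normal[OF H, of "sqrt v" x] that by simp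
  ultimately show thesis by (rule that[OF H(1)])
qed

lemma heat_deriv_low_order:
  assumes v: "v > 0"
  shows "(heat_deriv 0 v has_real_derivative heat_deriv 1 v x) (at x)"
    and "(heat_deriv 1 v has_real_derivative heat_deriv 2 v x) (at x)"
    and "\<bar>heat_deriv 1 v x\<bar> \<le> 1/2"
    and "((\<lambda>v. heat_deriv 0 v x) has_real_derivative heat_deriv 2 v x / 2) (at v)"
proof -
  obtain H where H: "\<And>x. (H has_real_derivative std_normal_density x) (at x)"
    "\<And>x. \<bar>H x\<bar> \<le> 1/2"
    and h: "\<And>v x. v > 0 \<Longrightarrow>
       heat_solution 1 v 0 x = sqrt v * std_normal_density (x / sqrt v) - x * H (- x / sqrt v)"
    by (rule heat_solution_closed_form) (rule that)
  note [derivative_intros] = DERIV_chain2[OF H(1)]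
  have minus: "std_normal_density (- x / a) = std_normal_density (x / a)"
      "std_normal_density (- (x / a)) = std_normal_density (x / a)" for x a
    using std_normal_density_minus[of "x / a"] by simp_all
  have first: "(heat_solution 1 v 0 has_real_derivative - H (- x / sqrt v)) (at x)" for x
  proof -
    have "((\<lambda>x. sqrt v * std_normal_density (x / sqrt v) - x * H (- x / sqrt v))
        has_real_derivative - H (- x / sqrt v)) (at x)"
      using v by (auto intro!: derivative_eq_intros simp: minus field_simps)
    then show ?thesis using h[OF v] by presburger
  qed
  have zeroth: "heat_deriv 0 v = heat_solution 1 v 0" by (rule ext) simp
  have order1: "heat_deriv 1 v = (\<lambda>x. - H (- x / sqrt v))"
    by (rule ext) (use DERIV_imp_deriv[OF first] in simp)
  show "(heat_deriv 0 v has_real_derivative heat_deriv 1 v x) (at x)"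
    unfolding zeroth order1 by (rule first)
  show "(heat_deriv 1 v has_real_derivative heat_deriv 2 v x) (at x)"
    unfolding order1 using v
    by (auto intro!: derivative_eq_intros simp: minus numeral_2_eq_2 field_simps)
  show "\<bar>heat_deriv 1 v x\<bar> \<le> 1/2"
    unfolding order1 abs_minus_cancel by (rule H(2))
  have "((\<lambda>v. sqrt v * std_normal_density (x / sqrt v) - x * H (- x / sqrt v))
      has_real_derivative heat_deriv 2 v x / 2) (at v)"
    using v by (auto intro!: derivative_eq_intros simp: minus numeral_2_eq_2 field_simps)
  moreover have "eventually (\<lambda>v. sqrt v * std_normal_density (x / sqrt v) - x * H (- x / sqrt v)
      = heat_deriv 0 v x) (nhds v)"
    using eventually_nhds_in_open[of "{0<..}" v] v by (auto elim!: eventually_mono simp: h)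
  ultimately show "((\<lambda>v. heat_deriv 0 v x) has_real_derivative heat_deriv 2 v x / 2) (at v)"
    by (subst (asm) DERIV_cong_ev[OF refl _ refl])
qed

lemma DERIV_heat_deriv:
  assumes "v > 0"
  shows "(heat_deriv n v has_real_derivative heat_deriv (Suc n) v x) (at x)"
proof -
  consider "n = 0" | "n = 1" | k where "n = Suc (Suc k)"
    by (metis One_nat_def not0_implies_Suc)
  then show ?thesis
  proof cases
    case 1
    with heat_deriv_low_order(1)[OF assms, of x] show ?thesis by simp
  next
    case 2
    with heat_deriv_low_order(2)[OF assms, of x] show ?thesis by (simp add: numeral_2_eq_2)
  next
    case 3
    have "((\<lambda>x. gauss_deriv k (x / sqrt v) / sqrt v ^ Suc k) has_real_derivative
        gauss_deriv (Suc k) (x / sqrt v) / sqrt v ^ Suc (Suc k)) (at x)"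
      using assms by (auto intro!: derivative_eq_intros DERIV_chain2[OF DERIV_gauss_deriv])
    moreover have "heat_deriv n v = (\<lambda>x. gauss_deriv k (x / sqrt v) / sqrt v ^ Suc k)"
      unfolding 3 by auto
    ultimately show ?thesis using 3 by simp
  qed
qed

lemma DERIV_heat_deriv_time:
  assumes "v > 0" "n \<noteq> 1"
  shows "((\<lambda>v. heat_deriv n v x) has_real_derivative heat_deriv (n + 2) v x / 2) (at v)"
proof (cases n)
  case 0
  with heat_deriv_low_order(4)[OF assms(1), of x] 0 show ?thesis by (simp add: numeral_2_eq_2)
next
  case (Suc n')
  then obtain k where n: "n = Suc (Suc k)" using assms(2) by (cases n') auto
  define s where "s = sqrt v"
  have s: "s > 0" "s\<^sup>2 = v" using assms(1) by (auto simp: s_def)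
  \<comment> \<open>In the standard deviation \<open>s\<close> the scaling is by integer powers, and the Hermite recurrence collects the two terms of the quotient rule.\<close>
  have "((\<lambda>s. gauss_deriv k (x / s) / s ^ Suc k) has_real_derivative
      gauss_deriv (Suc (Suc k)) (x / s) / s ^ Suc (Suc k)) (at s)"
  proof -
    have "((\<lambda>s. gauss_deriv k (x / s) / s ^ Suc k) has_real_derivative
      (gauss_deriv (Suc k) (x / s) * (- x / s\<^sup>2) * s ^ Suc k
        - gauss_deriv k (x / s) * (real (Suc k) * s ^ k)) / (s ^ Suc k * s ^ Suc k)) (at s)"
      using s by (auto intro!: derivative_eq_intros DERIV_chain2[OF DERIV_gauss_deriv]
          simp: power2_eq_square simp del: power_Suc)
    moreover have "(gauss_deriv (Suc k) (x / s) * (- x / s\<^sup>2) * s ^ Suc k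
        - gauss_deriv k (x / s) * (real (Suc k) * s ^ k)) / (s ^ Suc k * s ^ Suc k)
        = gauss_deriv (Suc (Suc k)) (x / s) / s ^ Suc (Suc k)"
      using s(1) by (simp add: field_simps power2_eq_square)
    ultimately show ?thesis by simp
  qed
  then have "((\<lambda>v. gauss_deriv k (x / sqrt v) / sqrt v ^ Suc k) has_real_derivative
      gauss_deriv (Suc (Suc k)) (x / s) / s ^ Suc (Suc k) * (inverse s / 2)) (at v)"
    using DERIV_real_sqrt[OF assms(1)] unfolding s_def by (rule DERIV_chain2)
  moreover have "heat_deriv (n + 2) v x / 2
      = gauss_deriv (Suc (Suc k)) (x / s) / s ^ Suc (Suc k) * (inverse s / 2)"
    using s(1) by (simp add: n s_def[symmetric] field_simps)
  moreover have "(\<lambda>v. heat_deriv n v x) = (\<lambda>v. gauss_deriv k (x / sqrt v) / sqrt v ^ Suc k)"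
    unfolding n by auto
  ultimately show ?thesis by simp
qed

section \<open>Decay as the variance grows\<close>

text \<open>
  Bounds of order \<open>v\<^sup>-\<^sup>p\<^sup>/\<^sup>2\<close>, uniform in \<open>x\<close> and in \<open>v \<ge> 1\<close>. The heat derivatives
  blow up at \<open>v = 0\<close>, which is why \<open>v\<close> starts at 1. Keeping the constant existential lets
  Taylor remainders be added up without tracking it.
\<close>

definition decays :: "nat \<Rightarrow> (real \<Rightarrow> real \<Rightarrow> real) \<Rightarrow> bool" where
  "decays p F \<longleftrightarrow> (\<exists>K. \<forall>v\<ge>1. \<forall>x. \<bar>F v x\<bar> \<le> K / sqrt v ^ p)"

lemma decaysI: "(\<And>v x. v \<ge> 1 \<Longrightarrow> \<bar>F v x\<bar> \<le> K / sqrt v ^ p) \<Longrightarrow> decays p F"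
  unfolding decays_def by blast

lemma decaysE:
  assumes "decays p F"
  obtains K where "K \<ge> 0" "\<And>v x. v \<ge> 1 \<Longrightarrow> \<bar>F v x\<bar> \<le> K / sqrt v ^ p"
proof -
  obtain K where K: "\<And>v x. v \<ge> 1 \<Longrightarrow> \<bar>F v x\<bar> \<le> K / sqrt v ^ p"
    using assms unfolding decays_def by blast
  have "0 \<le> \<bar>F 1 0\<bar>" by simp
  also have "\<dots> \<le> K" using K[of 1 0] by simp
  finally have "0 \<le> K" .
  with K that show thesis by blast
qed

lemma decays_add:
  assumes "decays p F" "decays p G"
  shows "decays p (\<lambda>v x. F v x + G v x)"
proof -
  obtain K where "K \<ge> 0" and K: "\<And>v x. v \<ge> 1 \<Longrightarrow> \<bar>F v x\<bar> \<le> K / sqrt v ^ p"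
    using assms(1) by (rule decaysE) (rule that)
  obtain L where "L \<ge> 0" and L: "\<And>v x. v \<ge> 1 \<Longrightarrow> \<bar>G v x\<bar> \<le> L / sqrt v ^ p"
    using assms(2) by (rule decaysE) (rule that)
  have "\<bar>F v x + G v x\<bar> \<le> (K + L) / sqrt v ^ p" if "v \<ge> 1" for v x
    unfolding add_divide_distrib using K[OF that, of x] L[OF that, of x] by linarith
  then show ?thesis by (rule decaysI)
qed

lemma decays_cmult:
  assumes "decays p F"
  shows "decays p (\<lambda>v x. a * F v x)"
proof -
  obtain K where "K \<ge> 0" and K: "\<And>v x. v \<ge> 1 \<Longrightarrow> \<bar>F v x\<bar> \<le> K / sqrt v ^ p"
    using assms by (rule decaysE) (rule that)
  have "\<bar>a * F v x\<bar> \<le> (\<bar>a\<bar> * K) / sqrt v ^ p" if "v \<ge> 1" for v x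
    using mult_left_mono[OF K[OF that, of x], of "\<bar>a\<bar>"] by (simp add: abs_mult)
  then show ?thesis by (rule decaysI)
qed

lemma decays_diff:
  "decays p F \<Longrightarrow> decays p G \<Longrightarrow> decays p (\<lambda>v x. F v x - G v x)"
  using decays_add[of p F "\<lambda>v x. - 1 * G v x"] decays_cmult[of p G "-1"] by simp

lemma decays_mono:
  assumes "decays q F" "p \<le> q"
  shows "decays p F"
proof -
  obtain K where K: "K \<ge> 0" "\<And>v x. v \<ge> 1 \<Longrightarrow> \<bar>F v x\<bar> \<le> K / sqrt v ^ q"
    using assms(1) by (rule decaysE) (rule that)
  have "\<bar>F v x\<bar> \<le> K / sqrt v ^ p" if v: "v \<ge> 1" for v x
  proof -
    have "K / sqrt v ^ q \<le> K / sqrt v ^ p"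
      using v K(1) assms(2) by (intro divide_left_mono power_increasing) auto
    with K(2)[OF v, of x] show ?thesis by linarith
  qed
  then show ?thesis by (rule decaysI)
qed

lemma decays_mult_variance:
  assumes "decays (p + 2) F"
  shows "decays p (\<lambda>v x. v * F v x)"
proof -
  obtain K where "K \<ge> 0" and K: "\<And>v x. v \<ge> 1 \<Longrightarrow> \<bar>F v x\<bar> \<le> K / sqrt v ^ (p + 2)"
    using assms by (rule decaysE) (rule that)
  have "\<bar>v * F v x\<bar> \<le> K / sqrt v ^ p" if v: "v \<ge> 1" for v x
  proof -
    have "\<bar>v * F v x\<bar> \<le> v * (K / sqrt v ^ (p + 2))"
      using mult_left_mono[OF K[OF v, of x], of v] v by (simp add: abs_mult)
    also have "\<dots> = K / sqrt v ^ p"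
      unfolding power_add using v by simp
    finally show ?thesis .
  qed
  then show ?thesis by (rule decaysI)
qed

lemma decays_shift: "decays p F \<Longrightarrow> decays p (\<lambda>v x. F v (x + d))"
  unfolding decays_def by blast

lemma decays_Taylor_space:
  assumes D: "\<And>n v x. v > 0 \<Longrightarrow> (F n v has_real_derivative F (Suc n) v x) (at x)"
    and "decays p (F n)"
  shows "decays p (\<lambda>v x. F 0 v (x + d) - (\<Sum>k<n. F k v x / fact k * d ^ k))"
proof -
  obtain K where "K \<ge> 0" and K: "\<And>v x. v \<ge> 1 \<Longrightarrow> \<bar>F n v x\<bar> \<le> K / sqrt v ^ p"
    using assms(2) by (rule decaysE) (rule that)
  have "\<bar>F 0 v (x + d) - (\<Sum>k<n. F k v x / fact k * d ^ k)\<bar> \<le> (\<bar>d ^ n / fact n\<bar> * K) / sqrt v ^ p"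
    if v: "v \<ge> 1" for v x
  proof -
    have "\<exists>t. \<bar>t\<bar> \<le> \<bar>d\<bar> \<and> (\<lambda>y. F 0 v (x + y)) d
        = (\<Sum>m<n. ((\<lambda>y. F m v (x + y)) 0 / fact m) * d ^ m) + ((\<lambda>y. F n v (x + y)) t / fact n) * d ^ n"
    proof (rule Maclaurin_all_le[where diff = "\<lambda>m y. F m v (x + y)"])
      have "((\<lambda>y. F m v (x + y)) has_real_derivative F (Suc m) v (x + y)) (at y)" for m y
        using D[of v m "y + x"] v unfolding DERIV_shift by (simp add: add.commute)
      then show "\<forall>m y. ((\<lambda>y. F m v (x + y)) has_real_derivative F (Suc m) v (x + y)) (at y)"
        by blast
    qed simp
    then obtain t where "F 0 v (x + d) - (\<Sum>k<n. F k v x / fact k * d ^ k) = (d ^ n / fact n) * F n v (x + t)"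
      by (auto simp: field_simps)
    then show ?thesis
      using mult_left_mono[OF K[OF v, of "x + t"], of "\<bar>d ^ n / fact n\<bar>"] by (simp add: abs_mult)
  qed
  then show ?thesis by (rule decaysI)
qed

lemma decays_Taylor_time:
  assumes D: "\<And>k v x. v > 0 \<Longrightarrow> k < n \<Longrightarrow> ((\<lambda>v. F k v x) has_real_derivative F (Suc k) v x) (at v)"
    and "decays p (F n)" "0 < c" "0 < n"
  shows "decays p (\<lambda>v x. F 0 (v + c) x - (\<Sum>k<n. F k v x / fact k * c ^ k))"
proof -
  obtain K where K: "K \<ge> 0" "\<And>v x. v \<ge> 1 \<Longrightarrow> \<bar>F n v x\<bar> \<le> K / sqrt v ^ p"
    using assms(2) by (rule decaysE) (rule that)
  have "\<bar>F 0 (v + c) x - (\<Sum>k<n. F k v x / fact k * c ^ k)\<bar> \<le> (c ^ n / fact n * K) / sqrt v ^ p"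
    if v: "v \<ge> 1" for v x
  proof -
    have "\<exists>t. v < t \<and> t < v + c \<and> F 0 (v + c) x
        = (\<Sum>m<n. (F m v x / fact m) * (v + c - v) ^ m) + (F n t x / fact n) * (v + c - v) ^ n"
      using v assms by (intro Taylor_up[where diff = "\<lambda>m v. F m v x" and a = v]) auto
    then obtain t where t: "v < t" and
      eq: "F 0 (v + c) x - (\<Sum>k<n. F k v x / fact k * c ^ k) = (c ^ n / fact n) * F n t x"
      by (auto simp: field_simps)
    have "\<bar>F n t x\<bar> \<le> K / sqrt t ^ p" using K(2) t v by simp
    also have "\<dots> \<le> K / sqrt v ^ p"
      using t v K(1) by (intro divide_left_mono power_mono mult_pos_pos) auto
    finally show ?thesis
      unfolding eq using mult_left_mono[of "\<bar>F n t x\<bar>" "K / sqrt v ^ p" "c ^ n / fact n"] assms(3)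
      by (simp add: abs_mult)
  qed
  then show ?thesis by (rule decaysI)
qed

text \<open>
  Parabolic scaling: at fixed \<open>x/\<surd>v\<close> the solution grows like \<open>\<surd>v\<close>, and every derivative gains a factor \<open>1/\<surd>v\<close>.
\<close>

lemma decays_heat_deriv:
  assumes "n > 0"
  shows "decays (n - 1) (heat_deriv n)"
proof -
  obtain n' where n': "n = Suc n'" using assms by (cases n) auto
  show ?thesis
  proof (cases n')
    case 0
    have "\<bar>heat_deriv 1 v x\<bar> \<le> (1/2) / sqrt v ^ 0" if "v \<ge> 1" for v x
      using heat_deriv_low_order(3)[of v x] that by simp
    then have "decays 0 (heat_deriv 1)" by (rule decaysI)
    with 0 n' show ?thesis by simp
  next
    case (Suc k)
    obtain K where K: "\<And>z. \<bar>gauss_deriv k z\<bar> \<le> K"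
      using gauss_deriv_moment_bounded[of 0 k] by auto
    have "\<bar>heat_deriv n v x\<bar> \<le> K / sqrt v ^ Suc k" if "v \<ge> 1" for v x
      unfolding n' Suc using K that by (auto simp: abs_divide abs_mult intro!: divide_right_mono)
    then show ?thesis unfolding n' Suc by (intro decaysI) auto
  qed
qed

section \<open>The corrected heat solution\<close>

text \<open>
  Write the increment in state \<open>m\<close> as \<open>q m - r m = \<alpha> + \<beta>\<sigma>\<close>, where \<open>\<sigma> = 1\<close> in state 1 and \<open>\<sigma> = -1\<close> in
  state 0. The walk with increments \<open>b(\<alpha> + \<beta>\<sigma>)\<close> has variance \<open>\<alpha>\<^sup>2 + \<beta>\<^sup>2\<close> per step on average, and its third
  cumulant grows by \<open>6\<alpha>\<^sup>2\<beta>\<close> per step, because the state \<open>\<sigma>\<close> is the previous \<open>b\<close>. The function of order 0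
  is the first Edgeworth correction of \<open>h\<close> for this skewness, namely \<open>U = h + \<mu> v h\<^sub>x\<^sub>x\<^sub>x\<close> with
  \<open>\<mu> = \<alpha>\<^sup>2\<beta>/(\<alpha>\<^sup>2 + \<beta>\<^sup>2)\<close>; it solves \<open>U\<^sub>v = U\<^sub>x\<^sub>x/2 + \<mu> h\<^sub>x\<^sub>x\<^sub>x\<close>. The order \<open>n\<close> is its \<open>n\<close>-th spatial derivative.
\<close>

definition edgeworth :: "real \<Rightarrow> real \<Rightarrow> nat \<Rightarrow> real \<Rightarrow> real \<Rightarrow> real" where
  "edgeworth \<alpha> \<beta> n v x =
     heat_deriv n v x + \<alpha>\<^sup>2 * \<beta> / (\<alpha>\<^sup>2 + \<beta>\<^sup>2) * (v * heat_deriv (n + 3) v x)"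

text \<open>
  The terms with \<open>\<sigma>\<close> are the correctors of homogenization. They absorb the deviation of the one-step
  variance \<open>(\<alpha> + \<beta>\<sigma>)\<^sup>2 = \<alpha>\<^sup>2 + \<beta>\<^sup>2 + 2\<alpha>\<beta>\<sigma>\<close> from its mean, and the deviation at third order that the
  first corrector creates.
\<close>

definition corrected_heat :: "real \<Rightarrow> real \<Rightarrow> real \<Rightarrow> real \<Rightarrow> real \<Rightarrow> real" where
  "corrected_heat \<alpha> \<beta> \<sigma> v x = edgeworth \<alpha> \<beta> 0 v x
     + \<sigma> * (\<alpha> * \<beta> * edgeworth \<alpha> \<beta> 2 v x + \<alpha> * \<beta>\<^sup>2 * heat_deriv 3 v x)"

text \<open>
  The factor \<open>v\<close> of the skewness term costs two powers of \<open>\<surd>v\<close>, the three extra derivatives gain three.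
\<close>

lemma decays_variance_heat_deriv: "decays n (\<lambda>v x. v * heat_deriv (n + 3) v x)"
  using decays_mult_variance[of n "heat_deriv (n + 3)"] decays_heat_deriv[of "n + 3"] by simp

lemma decays_edgeworth:
  assumes "n > 0"
  shows "decays (n - 1) (edgeworth \<alpha> \<beta> n)"
  unfolding edgeworth_def
  by (intro decays_add decays_cmult decays_heat_deriv[OF assms]
      decays_mono[OF decays_variance_heat_deriv]) simp

lemma DERIV_edgeworth:
  assumes "v > 0"
  shows "(edgeworth \<alpha> \<beta> n v has_real_derivative edgeworth \<alpha> \<beta> (Suc n) v x) (at x)"
proof -
  have "((\<lambda>x. heat_deriv n v x + \<alpha>\<^sup>2 * \<beta> / (\<alpha>\<^sup>2 + \<beta>\<^sup>2) * (v * heat_deriv (n + 3) v x))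
      has_real_derivative edgeworth \<alpha> \<beta> (Suc n) v x) (at x)"
    unfolding edgeworth_def add_Suc
    by (intro DERIV_add DERIV_cmult DERIV_heat_deriv assms)
  then show ?thesis by (simp add: edgeworth_def[abs_def])
qed

lemma DERIV_edgeworth_time:
  assumes "v > 0" "n \<noteq> 1"
  shows "((\<lambda>v. edgeworth \<alpha> \<beta> n v x) has_real_derivative
     edgeworth \<alpha> \<beta> (n + 2) v x / 2 + \<alpha>\<^sup>2 * \<beta> / (\<alpha>\<^sup>2 + \<beta>\<^sup>2) * heat_deriv (n + 3) v x) (at v)"
proof -
  have "((\<lambda>v. edgeworth \<alpha> \<beta> n v x) has_real_derivative
     heat_deriv (n + 2) v x / 2 + \<alpha>\<^sup>2 * \<beta> / (\<alpha>\<^sup>2 + \<beta>\<^sup>2)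
       * (1 * heat_deriv (n + 3) v x + heat_deriv (n + 3 + 2) v x / 2 * v)) (at v)"
    unfolding edgeworth_def using assms
    by (intro DERIV_add DERIV_cmult DERIV_mult DERIV_heat_deriv_time DERIV_ident) auto
  moreover have "n + 3 + 2 = n + 2 + 3" by simp
  ultimately show ?thesis
    unfolding edgeworth_def by (simp only:) (simp add: algebra_simps add_divide_distrib)
qed

text \<open>
  With the correctors all terms up to third order cancel, and what remains are fourth derivatives or
  smaller, of order \<open>v\<^sup>-\<^sup>3\<^sup>/\<^sup>2\<close>. This exponent matters: the errors of the steps can be summed. Without the
  skewness correction a term in \<open>h\<^sub>x\<^sub>x\<^sub>x\<close>, of order \<open>1/v\<close>, would in general survive, and such a sum diverges logarithmically
  in the number of steps.
\<close>

lemma corrected_heat_one_step: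
  fixes \<alpha> \<beta> \<sigma> :: real
  defines "d \<equiv> \<alpha> + \<beta> * \<sigma>" and "c \<equiv> \<alpha>\<^sup>2 + \<beta>\<^sup>2"
  assumes "\<sigma>\<^sup>2 = 1" and "c > 0"
  shows "decays 3 (\<lambda>v x. (corrected_heat \<alpha> \<beta> 1 v (x + d) + corrected_heat \<alpha> \<beta> (- 1) v (x - d)) / 2
     - corrected_heat \<alpha> \<beta> \<sigma> (v + c) x)"
proof -
  define \<mu> where "\<mu> = \<alpha>\<^sup>2 * \<beta> / c"
  have c\<mu>: "c * \<mu> = \<alpha>\<^sup>2 * \<beta>" using \<open>c > 0\<close> by (simp add: \<mu>_def)
  let ?E = "edgeworth \<alpha> \<beta>" and ?h = heat_deriv
  note E4 = decays_edgeworth[of 4 \<alpha> \<beta>, simplified]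
  have h4: "decays 3 (?h 4)" using decays_heat_deriv[of 4] by simp
  have h5: "decays 3 (?h 5)" by (rule decays_mono[OF decays_heat_deriv]) auto
  define R0 where "R0 a v x = ?E 0 v (x + a)
    - (?E 0 v x + ?E 1 v x * a + ?E 2 v x / 2 * a\<^sup>2 + ?E 3 v x / 6 * a ^ 3)" for a v x
  have R0: "decays 3 (R0 a)" for a
    using decays_Taylor_space[of ?E 3 4 a] DERIV_edgeworth E4
    by (simp add: R0_def[abs_def] eval_nat_numeral fact_reduce lessThan_Suc algebra_simps)
  define R2 where "R2 a v x = ?E 2 v (x + a) - (?E 2 v x + ?E 3 v x * a)" for a v x
  have R2: "decays 3 (R2 a)" for a
    using decays_Taylor_space[of "\<lambda>k. ?E (k + 2)" 3 2 a] DERIV_edgeworth E4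
    by (simp add: R2_def[abs_def] eval_nat_numeral lessThan_Suc algebra_simps)
  define R3 where "R3 a v x = ?h 3 v (x + a) - ?h 3 v x" for a v x
  have R3: "decays 3 (R3 a)" for a
    using decays_Taylor_space[of "\<lambda>k. ?h (k + 3)" 3 1 a] DERIV_heat_deriv h4
    by (simp add: R3_def[abs_def] eval_nat_numeral lessThan_Suc del: heat_deriv.simps)
  define T0 where "T0 v x = ?E 0 (v + c) x - (?E 0 v x + (?E 2 v x / 2 + \<mu> * ?h 3 v x) * c)" for v x
  define F where "F = (\<lambda>k. [?E 0, \<lambda>v x. 1/2 * ?E 2 v x + \<mu> * ?h 3 v x,
    \<lambda>v x. 1/2 * (?E 4 v x / 2 + \<mu> * ?h 5 v x) + \<mu> * (1/2 * ?h 5 v x)] ! k)"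
  have T0: "decays 3 T0"
  proof -
    have "((\<lambda>v. F k v x) has_real_derivative F (Suc k) v x) (at v)" if "v > 0" "k < 2" for k v x
    proof -
      consider "k = 0" | "k = 1" using \<open>k < 2\<close> by linarith
      then show ?thesis
      proof cases
        case 1
        show ?thesis
          using DERIV_edgeworth_time[OF \<open>v > 0\<close>, of 0 \<alpha> \<beta> x]
          unfolding 1 F_def \<mu>_def c_def by (simp add: numeral_2_eq_2 del: heat_deriv.simps)
      next
        case 2
        have "((\<lambda>v. 1/2 * ?E 2 v x + \<mu> * ?h 3 v x) has_real_derivative
            1/2 * (?E 4 v x / 2 + \<mu> * ?h 5 v x) + \<mu> * (?h 5 v x / 2)) (at v)"
          using DERIV_edgeworth_time[OF \<open>v > 0\<close>, of 2 \<alpha> \<beta> x] DERIV_heat_deriv_time[OF \<open>v > 0\<close>, of 3 x]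
          unfolding \<mu>_def c_def by (intro DERIV_add DERIV_cmult) (simp_all del: heat_deriv.simps)
        then show ?thesis unfolding 2 F_def by (simp del: heat_deriv.simps)
      qed
    qed
    moreover have "decays 3 (F 2)"
    proof -
      have "decays 3 (\<lambda>v x. 1/2 * (1/2 * ?E 4 v x + \<mu> * ?h 5 v x) + \<mu> * (1/2 * ?h 5 v x))"
        by (intro decays_add decays_cmult h5 E4)
      then show ?thesis unfolding F_def by (simp del: heat_deriv.simps)
    qed
    ultimately have "decays 3 (\<lambda>v x. F 0 (v + c) x - (\<Sum>k<2. F k v x / fact k * c ^ k))"
      using \<open>c > 0\<close> by (intro decays_Taylor_time) auto
    then show ?thesis
      unfolding F_def T0_def[abs_def] by (simp add: numeral_2_eq_2 lessThan_Suc algebra_simps del: heat_deriv.simps)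
  qed
  define T2 where "T2 v x = ?E 2 (v + c) x - ?E 2 v x" for v x
  have T2: "decays 3 T2"
  proof -
    have "decays 3 (\<lambda>v x. (\<lambda>k. [?E 2, \<lambda>v x. 1/2 * ?E 4 v x + \<mu> * ?h 5 v x] ! k) 0 (v + c) x
      - (\<Sum>k<1. (\<lambda>k. [?E 2, \<lambda>v x. 1/2 * ?E 4 v x + \<mu> * ?h 5 v x] ! k) k v x / fact k * c ^ k))"
    proof (rule decays_Taylor_time)
      show "decays 3 ([?E 2, \<lambda>v x. 1/2 * ?E 4 v x + \<mu> * ?h 5 v x] ! 1)"
        using decays_add[OF decays_cmult[OF E4, of "1/2"] decays_cmult[OF h5, of \<mu>]]
        by (simp del: heat_deriv.simps)
      show "((\<lambda>v. ([?E 2, \<lambda>v x. 1/2 * ?E 4 v x + \<mu> * ?h 5 v x] ! k) v x) has_real_derivative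
          ([?E 2, \<lambda>v x. 1/2 * ?E 4 v x + \<mu> * ?h 5 v x] ! Suc k) v x) (at v)" if "v > 0" "k < 1" for k v x
        using DERIV_edgeworth_time[of v 2 \<alpha> \<beta> x] that
        by (simp add: \<mu>_def c_def del: heat_deriv.simps)
    qed (use \<open>c > 0\<close> in auto)
    then show ?thesis by (simp add: T2_def[abs_def])
  qed
  define T3 where "T3 v x = ?h 3 (v + c) x - ?h 3 v x" for v x
  have T3: "decays 3 T3"
  proof -
    have "decays 3 (\<lambda>v x. (\<lambda>k. [?h 3, \<lambda>v x. 1/2 * ?h 5 v x] ! k) 0 (v + c) x
      - (\<Sum>k<1. (\<lambda>k. [?h 3, \<lambda>v x. 1/2 * ?h 5 v x] ! k) k v x / fact k * c ^ k))"
    proof (rule decays_Taylor_time)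
      show "decays 3 ([?h 3, \<lambda>v x. 1/2 * ?h 5 v x] ! 1)"
        using decays_cmult[OF h5, of "1/2"] by (simp del: heat_deriv.simps)
      show "((\<lambda>v. ([?h 3, \<lambda>v x. 1/2 * ?h 5 v x] ! k) v x) has_real_derivative
          ([?h 3, \<lambda>v x. 1/2 * ?h 5 v x] ! Suc k) v x) (at v)" if "v > 0" "k < 1" for k v x
        using DERIV_heat_deriv_time[of v 3 x] that by (simp del: heat_deriv.simps)
    qed (use \<open>c > 0\<close> in auto)
    then show ?thesis by (simp add: T3_def[abs_def] del: heat_deriv.simps)
  qed
  define S where "S v x = ?E 3 v x - ?h 3 v x" for v x
  have S: "decays 3 S"
    using decays_cmult[OF decays_variance_heat_deriv[of 3], of \<mu>]
    by (simp add: S_def[abs_def] edgeworth_def \<mu>_def c_def)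
  \<comment> \<open>\<open>R0\<close>, \<open>R2\<close>, \<open>R3\<close> are the spatial and \<open>T0\<close>, \<open>T2\<close>, \<open>T3\<close> the temporal Taylor remainders of the three summands of the corrected solution.\<close>
  have "decays 3 (\<lambda>v x. 1/2 * (R0 d v x + R0 (- d) v x) + \<alpha> * \<beta> / 2 * (R2 d v x - R2 (- d) v x)
      + \<alpha> * \<beta>\<^sup>2 / 2 * (R3 d v x - R3 (- d) v x) - T0 v x - \<sigma> * \<alpha> * \<beta> * T2 v x
      - \<sigma> * \<alpha> * \<beta>\<^sup>2 * T3 v x + \<alpha> * \<beta> * d * S v x)" (is "decays 3 ?L")
    by (intro decays_add decays_diff decays_cmult R0 R2 R3 T0 T2 T3 S)
  also have "?L = (\<lambda>v x. (corrected_heat \<alpha> \<beta> 1 v (x + d) + corrected_heat \<alpha> \<beta> (- 1) v (x - d)) / 2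
     - corrected_heat \<alpha> \<beta> \<sigma> (v + c) x)"
  proof (intro ext)
    fix v x
    have E2: "d\<^sup>2 = c + 2 * \<sigma> * \<alpha> * \<beta>"
      using assms(3) by (simp add: d_def c_def power2_sum power_mult_distrib)
    have "?L v x - ((corrected_heat \<alpha> \<beta> 1 v (x + d) + corrected_heat \<alpha> \<beta> (- 1) v (x - d)) / 2
        - corrected_heat \<alpha> \<beta> \<sigma> (v + c) x)
      = ?E 2 v x * (c / 2 + \<sigma> * \<alpha> * \<beta> - d\<^sup>2 / 2)
        + ?h 3 v x * (c * \<mu> + \<sigma> * \<alpha> * \<beta>\<^sup>2 - \<alpha> * \<beta> * d)"
      unfolding R0_def R2_def R3_def T0_def T2_def T3_def S_def corrected_heat_def
      by (simp add: field_simps power2_eq_square power3_eq_cube del: heat_deriv.simps)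
    also have "\<dots> = 0"
      unfolding E2 c\<mu> unfolding d_def by (simp add: algebra_simps power2_eq_square)
    finally show "?L v x = (corrected_heat \<alpha> \<beta> 1 v (x + d) + corrected_heat \<alpha> \<beta> (- 1) v (x - d)) / 2
        - corrected_heat \<alpha> \<beta> \<sigma> (v + c) x" by simp
  qed
  finally show ?thesis .
qed

lemma corrected_heat_near_heat: "decays 0 (\<lambda>v x. corrected_heat \<alpha> \<beta> \<sigma> v x - heat_deriv 0 v x)"
proof -
  have "decays 0 (\<lambda>v x. \<alpha>\<^sup>2 * \<beta> / (\<alpha>\<^sup>2 + \<beta>\<^sup>2) * (v * heat_deriv (0 + 3) v x)
      + \<sigma> * (\<alpha> * \<beta> * edgeworth \<alpha> \<beta> 2 v x + \<alpha> * \<beta>\<^sup>2 * heat_deriv 3 v x))"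
    by (intro decays_add decays_cmult decays_variance_heat_deriv
        decays_mono[OF decays_edgeworth] decays_mono[OF decays_heat_deriv]) auto
  then show ?thesis by (simp add: corrected_heat_def edgeworth_def[of _ _ 0] algebra_simps)
qed

text \<open>
  The difference of the values reached by the two moves determines the optimal \<open>f\<close>. Up to
  \<open>O(1/\<surd>v)\<close> it is the difference for the heat solution alone.
\<close>

lemma corrected_heat_spread:
  "decays 1 (\<lambda>v x. (corrected_heat \<alpha> \<beta> 1 v (x + d) - corrected_heat \<alpha> \<beta> (- 1) v (x - d))
     - (heat_deriv 0 v (x + d) - heat_deriv 0 v (x - d)))"
proof -
  have h3: "decays 1 (\<lambda>v x. v * heat_deriv 3 v (x + a) - v * heat_deriv 3 v x)" for a
  proof -
    have "((\<lambda>x. v * heat_deriv (k + 3) v x) has_real_derivative v * heat_deriv (Suc k + 3) v x) (at x)"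
      if "v > 0" for v x k
      using DERIV_cmult[OF DERIV_heat_deriv[OF that, of "k + 3" x], of v] by simp
    then show ?thesis
      using decays_Taylor_space[of "\<lambda>k v x. v * heat_deriv (k + 3) v x" 1 1 a]
        decays_variance_heat_deriv[of 1]
      by (simp add: lessThan_Suc del: heat_deriv.simps)
  qed
  have "decays 1 (\<lambda>v x. \<alpha>\<^sup>2 * \<beta> / (\<alpha>\<^sup>2 + \<beta>\<^sup>2)
        * ((v * heat_deriv 3 v (x + d) - v * heat_deriv 3 v x)
          - (v * heat_deriv 3 v (x + - d) - v * heat_deriv 3 v x))
      + \<alpha> * \<beta> * (edgeworth \<alpha> \<beta> 2 v (x + d) + edgeworth \<alpha> \<beta> 2 v (x + - d))
      + \<alpha> * \<beta>\<^sup>2 * (heat_deriv 3 v (x + d) + heat_deriv 3 v (x + - d)))" (is "decays 1 ?L")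
    using decays_edgeworth[of 2 \<alpha> \<beta>] decays_mono[OF decays_heat_deriv[of 3], of 1]
    by (intro decays_add decays_diff decays_cmult h3 decays_shift) auto
  also have "?L = (\<lambda>v x. (corrected_heat \<alpha> \<beta> 1 v (x + d) - corrected_heat \<alpha> \<beta> (- 1) v (x - d))
     - (heat_deriv 0 v (x + d) - heat_deriv 0 v (x - d)))"
    by (intro ext)
      (simp add: corrected_heat_def edgeworth_def[of _ _ 0] algebra_simps del: heat_deriv.simps)
  finally show ?thesis .
qed

lemma heat_deriv_0_Lipschitz:
  assumes "v > 0"
  shows "\<bar>heat_deriv 0 v x - heat_deriv 0 v y\<bar> \<le> \<bar>x - y\<bar> / 2"
  using field_differentiable_bound[OF convex_UNIV, of "heat_deriv 0 v" "heat_deriv 1 v" "1/2" x y]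
    DERIV_heat_deriv[OF assms, of 0] heat_deriv_low_order(3)[OF assms]
  by (simp del: heat_deriv.simps)

section \<open>Comparison with discrete super- and subsolutions\<close>

text \<open>
  The two arguments of the max depend on \<open>f\<close> with opposite slopes, so the best \<open>f\<close> makes them equal, and
  the min-max is the average of the two values, in which \<open>f\<close> cancels. The hypothesis \<open>move\<close> says that
  this equalizing \<open>f\<close> lies in \<open>[-1, 1]\<close>. Since \<open>\<bar>\<xi>\<bar>/2\<close> is positively homogeneous, \<open>W\<close> lives on the unit
  scale.
\<close>

lemma value_steps_le:
  fixes q r :: "nat \<Rightarrow> real" and W :: "nat \<Rightarrow> nat \<Rightarrow> real \<Rightarrow> real"
  assumes "\<epsilon> > 0" and "m \<in> {0, 1}"
    and final: "\<And>m x. m \<in> {0, 1} \<Longrightarrow> \<bar>x\<bar> / 2 \<le> W 0 m x"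
    and move: "\<And>N m x. m \<in> {0, 1} \<Longrightarrow>
      \<bar>q m + r m + (W N 1 (x + (q m - r m)) - W N 0 (x - (q m - r m)))\<bar> \<le> 2"
    and super: "\<And>N m x. m \<in> {0, 1} \<Longrightarrow>
      (W N 1 (x + (q m - r m)) + W N 0 (x - (q m - r m))) / 2 \<le> W (Suc N) m x"
  shows "value_steps q r classic_data \<epsilon> N m \<xi> \<eta> \<le> \<eta> / 2 + \<epsilon> * W N m (\<xi> / \<epsilon>)"
  using \<open>m \<in> {0, 1}\<close>
proof (induction N arbitrary: m \<xi> \<eta>)
  case 0
  show ?case
    using mult_left_mono[OF final[OF 0, of "\<xi> / \<epsilon>"], of \<epsilon>] \<open>\<epsilon> > 0\<close>
    by (simp add: classic_data_def add_divide_distrib)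
next
  case (Suc N)
  let ?d = "q m - r m" and ?v = "value_steps q r classic_data \<epsilon> N"
  define A where "A = W N 1 (\<xi> / \<epsilon> + ?d)"
  define B where "B = W N 0 (\<xi> / \<epsilon> - ?d)"
  define f where "f = (q m + r m + (A - B)) / 2"
  have f: "f \<in> {-1..1}"
    using move[OF Suc.prems, of N "\<xi> / \<epsilon>"] by (auto simp: f_def A_def B_def abs_le_iff)
  have "bdd_below (step_max q r \<epsilon> ?v m \<xi> \<eta> ` {-1..1})"
    by (intro bounded_imp_bdd_below compact_imp_bounded compact_continuous_image
        step_max_Lipschitz(2)[OF value_steps_Lipschitz]) auto
  then have "value_steps q r classic_data \<epsilon> (Suc N) m \<xi> \<eta> \<le> step_max q r \<epsilon> ?v m \<xi> \<eta> f"
    unfolding value_steps_Suc using f by (rule cINF_lower)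
  also have "\<dots> \<le> \<eta> / 2 + \<epsilon> * ((A + B) / 2)"
  proof -
    have "?v 1 (\<xi> + \<epsilon> * ?d) (\<eta> + \<epsilon> * (q m + r m - 2 * f))
        \<le> (\<eta> + \<epsilon> * (q m + r m - 2 * f)) / 2 + \<epsilon> * A"
      using Suc.IH[of 1 "\<xi> + \<epsilon> * ?d" "\<eta> + \<epsilon> * (q m + r m - 2 * f)"] \<open>\<epsilon> > 0\<close>
      by (simp add: A_def add_divide_distrib)
    moreover have "?v 0 (\<xi> - \<epsilon> * ?d) (\<eta> - \<epsilon> * (q m + r m - 2 * f))
        \<le> (\<eta> - \<epsilon> * (q m + r m - 2 * f)) / 2 + \<epsilon> * B"
      using Suc.IH[of 0 "\<xi> - \<epsilon> * ?d" "\<eta> - \<epsilon> * (q m + r m - 2 * f)"] \<open>\<epsilon> > 0\<close>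
      by (simp add: B_def diff_divide_distrib)
    moreover have e: "q m + r m - 2 * f = B - A" by (simp add: f_def field_simps)
    have "(\<eta> + \<epsilon> * (q m + r m - 2 * f)) / 2 + \<epsilon> * A = \<eta> / 2 + \<epsilon> * ((A + B) / 2)"
        "(\<eta> - \<epsilon> * (q m + r m - 2 * f)) / 2 + \<epsilon> * B = \<eta> / 2 + \<epsilon> * ((A + B) / 2)"
      unfolding e by (simp_all add: field_simps)
    ultimately show ?thesis
      unfolding step_max_def Max_pm next_state_def by simp
  qed
  also have "\<dots> \<le> \<eta> / 2 + \<epsilon> * W (Suc N) m (\<xi> / \<epsilon>)"
    using super[OF Suc.prems, of N "\<xi> / \<epsilon>"] \<open>\<epsilon> > 0\<close> by (simp add: A_def B_def)
  finally show ?case .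
qed

text \<open>
  The max is at least the average, and \<open>f\<close> drops out of the average; hence a lower bound holds for
  every \<open>f\<close>.
\<close>

lemma value_steps_ge:
  fixes q r :: "nat \<Rightarrow> real" and W :: "nat \<Rightarrow> nat \<Rightarrow> real \<Rightarrow> real"
  assumes "\<epsilon> > 0" and "m \<in> {0, 1}"
    and final: "\<And>m x. m \<in> {0, 1} \<Longrightarrow> W 0 m x \<le> \<bar>x\<bar> / 2"
    and sub: "\<And>N m x. m \<in> {0, 1} \<Longrightarrow>
      W (Suc N) m x \<le> (W N 1 (x + (q m - r m)) + W N 0 (x - (q m - r m))) / 2"
  shows "\<eta> / 2 + \<epsilon> * W N m (\<xi> / \<epsilon>) \<le> value_steps q r classic_data \<epsilon> N m \<xi> \<eta>"
  using \<open>m \<in> {0, 1}\<close>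
proof (induction N arbitrary: m \<xi> \<eta>)
  case 0
  show ?case
    using mult_left_mono[OF final[OF 0, of "\<xi> / \<epsilon>"], of \<epsilon>] \<open>\<epsilon> > 0\<close>
    by (simp add: classic_data_def add_divide_distrib)
next
  case (Suc N)
  let ?d = "q m - r m" and ?v = "value_steps q r classic_data \<epsilon> N"
  define A where "A = W N 1 (\<xi> / \<epsilon> + ?d)"
  define B where "B = W N 0 (\<xi> / \<epsilon> - ?d)"
  have "\<eta> / 2 + \<epsilon> * W (Suc N) m (\<xi> / \<epsilon>) \<le> \<eta> / 2 + \<epsilon> * ((A + B) / 2)"
    using sub[OF Suc.prems, of N "\<xi> / \<epsilon>"] \<open>\<epsilon> > 0\<close> by (simp add: A_def B_def)
  also have "\<dots> \<le> value_steps q r classic_data \<epsilon> (Suc N) m \<xi> \<eta>"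
    unfolding value_steps_Suc
  proof (rule cINF_greatest)
    fix f :: real
    have "(\<eta> + \<epsilon> * (q m + r m - 2 * f)) / 2 + \<epsilon> * A
        \<le> ?v 1 (\<xi> + \<epsilon> * ?d) (\<eta> + \<epsilon> * (q m + r m - 2 * f))"
      using Suc.IH[of 1 "\<eta> + \<epsilon> * (q m + r m - 2 * f)" "\<xi> + \<epsilon> * ?d"] \<open>\<epsilon> > 0\<close>
      by (simp add: A_def add_divide_distrib)
    moreover have "(\<eta> - \<epsilon> * (q m + r m - 2 * f)) / 2 + \<epsilon> * B
        \<le> ?v 0 (\<xi> - \<epsilon> * ?d) (\<eta> - \<epsilon> * (q m + r m - 2 * f))"
      using Suc.IH[of 0 "\<eta> - \<epsilon> * (q m + r m - 2 * f)" "\<xi> - \<epsilon> * ?d"] \<open>\<epsilon> > 0\<close>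
      by (simp add: B_def diff_divide_distrib)
    ultimately have "2 * (\<eta> / 2 + \<epsilon> * ((A + B) / 2))
        \<le> ?v 1 (\<xi> + \<epsilon> * ?d) (\<eta> + \<epsilon> * (q m + r m - 2 * f))
          + ?v 0 (\<xi> - \<epsilon> * ?d) (\<eta> - \<epsilon> * (q m + r m - 2 * f))"
      by (simp add: field_simps)
    then show "\<eta> / 2 + \<epsilon> * ((A + B) / 2) \<le> step_max q r \<epsilon> ?v m \<xi> \<eta> f"
      unfolding step_max_def Max_pm next_state_def by simp
  qed simp
  finally show ?case .
qed


section \<open>Barriers and the error estimate\<close>

lemma heat_solution_scaled:
  assumes "\<epsilon> > 0" "c * (T - t) = \<epsilon>\<^sup>2 * v" "v \<ge> 0"
  shows "heat_solution c T t \<xi> = \<epsilon> * heat_deriv 0 v (\<xi> / \<epsilon>)"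
proof -
  have "\<bar>\<xi> + sqrt (c * (T - t)) * z\<bar> * p = \<epsilon> * (\<bar>\<xi> / \<epsilon> + sqrt v * z\<bar> * p)" for z p :: real
  proof -
    have "\<xi> + sqrt (c * (T - t)) * z = \<epsilon> * (\<xi> / \<epsilon> + sqrt v * z)"
      using assms by (simp add: real_sqrt_mult algebra_simps)
    then show ?thesis using \<open>\<epsilon> > 0\<close> by (simp add: abs_mult)
  qed
  then show ?thesis
    by (simp only: heat_solution_std_normal heat_deriv.simps integral_mult_right_zero) simp
qed

lemma heat_deriv_0_initial: "\<bar>heat_deriv 0 v x - \<bar>x\<bar> / 2\<bar> \<le> sqrt v" if "v \<ge> 0"
proof -
  have "heat_solution 1 v v x = \<bar>x\<bar> / 2"
    using integral_std_normal_moment_even[of 0] by (simp add: heat_solution_std_normal)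
  with heat_solution_Lipschitz[of 1 v 0 x v x] that show ?thesis by simp
qed

text \<open>
  Replacing the kink \<open>\<bar>x\<bar>/2\<close> by the heat solution at a fixed variance \<open>v\<close>, where derivatives are
  bounded, changes the solution by at most \<open>\<surd>v\<close> at all later times.
\<close>

lemma heat_deriv_0_late_start:
  assumes "v \<ge> 0" "w \<ge> 0"
  shows "\<bar>heat_deriv 0 (v + w) x - heat_deriv 0 w x\<bar> \<le> sqrt v"
proof -
  have "heat_deriv 0 w x = heat_solution 1 (v + w) v x"
    by (simp add: heat_solution_std_normal)
  moreover have "sqrt (v + w) \<le> sqrt v + sqrt w" "sqrt w \<le> sqrt (v + w)"
    using assms by (simp_all add: sqrt_add_le_add_sqrt)
  ultimately show ?thesis
    using heat_solution_Lipschitz[of 1 "v + w" 0 x v x] by simp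
qed

text \<open>
  Summability of the one-step errors in telescoping form: a multiple of \<open>1/\<surd>v\<close> absorbs them.
\<close>

lemma power_decay_telescopes:
  fixes c v :: real
  assumes "c > 0" "v \<ge> 1"
  shows "1 / sqrt v ^ 3 \<le> 2 * (1 + c) / c * (1 / sqrt v - 1 / sqrt (v + c))"
proof -
  define s t where "s = sqrt v" and "t = sqrt (v + c)"
  have st: "0 < s" "s \<le> t" "t\<^sup>2 = s\<^sup>2 + c" "s\<^sup>2 = v" "t > 0"
    using assms by (auto simp: s_def t_def)
  have "c \<le> c * s\<^sup>2" using assms by (simp add: st(4))
  then have t2: "t\<^sup>2 \<le> (1 + c) * s\<^sup>2" unfolding st(3) by (simp add: algebra_simps)
  have "t * (s + t) \<le> t * (2 * t)" using st by (intro mult_left_mono) auto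
  also have "\<dots> \<le> 2 * (1 + c) * s\<^sup>2" using mult_left_mono[OF t2, of 2] by (simp add: power2_eq_square algebra_simps)
  finally have le: "t * (s + t) \<le> 2 * (1 + c) * s\<^sup>2" .
  have "(t - s) * (s + t) = c" using st(3) by (simp add: power2_eq_square algebra_simps)
  then have ts: "t - s = c / (s + t)" using st by (simp add: field_simps)
  have "1 / s - 1 / t = (t - s) / (s * t)" using st by (simp add: field_simps)
  also have "\<dots> = c / (s * (t * (s + t)))" using st by (simp add: ts)
  finally have eq: "2 * (1 + c) / c * (1 / s - 1 / t) = 2 * (1 + c) / (s * (t * (s + t)))"
    using assms by simp
  have "1 / s ^ 3 = 2 * (1 + c) / (s * (2 * (1 + c) * s\<^sup>2))"
    using assms st by (simp add: power3_eq_cube power2_eq_square)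
  also have "\<dots> \<le> 2 * (1 + c) / (s * (t * (s + t)))"
    using assms st le by (intro divide_left_mono mult_left_mono mult_pos_pos) auto
  finally show ?thesis using eq by (simp add: s_def t_def)
qed

text \<open>
  What the barriers need: the one-step error, the distance to the heat solution, and the spread that
  enters the optimal \<open>f\<close>. A single constant serves both states.
\<close>

lemma corrected_heat_bounds:
  fixes \<alpha> \<beta> :: real
  assumes "\<alpha>\<^sup>2 + \<beta>\<^sup>2 > 0"
  obtains K where "K \<ge> 0"
    "\<And>\<sigma> v x. \<sigma> \<in> {-1, 1} \<Longrightarrow> v \<ge> 1 \<Longrightarrow>
      \<bar>(corrected_heat \<alpha> \<beta> 1 v (x + (\<alpha> + \<beta> * \<sigma>)) + corrected_heat \<alpha> \<beta> (- 1) v (x - (\<alpha> + \<beta> * \<sigma>))) / 2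
         - corrected_heat \<alpha> \<beta> \<sigma> (v + (\<alpha>\<^sup>2 + \<beta>\<^sup>2)) x\<bar> \<le> K / sqrt v ^ 3"
    "\<And>\<sigma> v x. \<sigma> \<in> {-1, 1} \<Longrightarrow> v \<ge> 1 \<Longrightarrow> \<bar>corrected_heat \<alpha> \<beta> \<sigma> v x - heat_deriv 0 v x\<bar> \<le> K"
    "\<And>\<sigma> v x. \<sigma> \<in> {-1, 1} \<Longrightarrow> v \<ge> 1 \<Longrightarrow>
      \<bar>corrected_heat \<alpha> \<beta> 1 v (x + (\<alpha> + \<beta> * \<sigma>)) - corrected_heat \<alpha> \<beta> (- 1) v (x - (\<alpha> + \<beta> * \<sigma>))\<bar>
        \<le> \<bar>\<alpha> + \<beta> * \<sigma>\<bar> + K / sqrt v"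
proof -
  let ?G = "corrected_heat \<alpha> \<beta>" and ?c = "\<alpha>\<^sup>2 + \<beta>\<^sup>2"
  have "\<exists>K\<ge>0. \<forall>v\<ge>1. \<forall>x.
      \<bar>(?G 1 v (x + (\<alpha> + \<beta> * \<sigma>)) + ?G (- 1) v (x - (\<alpha> + \<beta> * \<sigma>))) / 2 - ?G \<sigma> (v + ?c) x\<bar>
        \<le> K / sqrt v ^ 3 \<and>
      \<bar>?G \<sigma> v x - heat_deriv 0 v x\<bar> \<le> K \<and>
      \<bar>?G 1 v (x + (\<alpha> + \<beta> * \<sigma>)) - ?G (- 1) v (x - (\<alpha> + \<beta> * \<sigma>))\<bar>
        \<le> \<bar>\<alpha> + \<beta> * \<sigma>\<bar> + K / sqrt v" if \<sigma>: "\<sigma>\<^sup>2 = 1" for \<sigma>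
  proof -
    define d where "d = \<alpha> + \<beta> * \<sigma>"
    obtain K1 where K1: "K1 \<ge> 0" "\<And>v x. v \<ge> 1 \<Longrightarrow>
        \<bar>(?G 1 v (x + d) + ?G (- 1) v (x - d)) / 2 - ?G \<sigma> (v + ?c) x\<bar> \<le> K1 / sqrt v ^ 3"
      using corrected_heat_one_step[OF \<sigma> assms, folded d_def] by (rule decaysE) (rule that)
    obtain K2 where K2: "K2 \<ge> 0" "\<And>v x. v \<ge> 1 \<Longrightarrow>
        \<bar>?G \<sigma> v x - heat_deriv 0 v x\<bar> \<le> K2 / sqrt v ^ 0"
      using corrected_heat_near_heat by (rule decaysE) (rule that)
    obtain K3 where K3: "K3 \<ge> 0" "\<And>v x. v \<ge> 1 \<Longrightarrow>
        \<bar>(?G 1 v (x + d) - ?G (- 1) v (x - d)) - (heat_deriv 0 v (x + d) - heat_deriv 0 v (x - d))\<bar>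
          \<le> K3 / sqrt v ^ 1"
      using corrected_heat_spread by (rule decaysE) (rule that)
    define K where "K = K1 + K2 + K3"
    have "\<bar>(?G 1 v (x + d) + ?G (- 1) v (x - d)) / 2 - ?G \<sigma> (v + ?c) x\<bar> \<le> K / sqrt v ^ 3
       \<and> \<bar>?G \<sigma> v x - heat_deriv 0 v x\<bar> \<le> K
       \<and> \<bar>?G 1 v (x + d) - ?G (- 1) v (x - d)\<bar> \<le> \<bar>d\<bar> + K / sqrt v" if v: "v \<ge> 1" for v x
    proof (intro conjI)
      have "K1 / sqrt v ^ 3 \<le> K / sqrt v ^ 3"
        using v K1(1) K2(1) K3(1) by (intro divide_right_mono) (auto simp: K_def)
      with K1(2)[OF v, of x]
      show "\<bar>(?G 1 v (x + d) + ?G (- 1) v (x - d)) / 2 - ?G \<sigma> (v + ?c) x\<bar> \<le> K / sqrt v ^ 3"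
        by linarith
      show "\<bar>?G \<sigma> v x - heat_deriv 0 v x\<bar> \<le> K"
        using K2(2)[OF v, of x] K1(1) K3(1) by (simp add: K_def del: heat_deriv.simps)
      have "K3 / sqrt v \<le> K / sqrt v"
        using v K1(1) K2(1) by (intro divide_right_mono) (auto simp: K_def)
      moreover have "\<bar>heat_deriv 0 v (x + d) - heat_deriv 0 v (x - d)\<bar> \<le> \<bar>d\<bar>"
        using heat_deriv_0_Lipschitz[of v "x + d" "x - d"] v by (simp add: abs_mult del: heat_deriv.simps)
      ultimately show "\<bar>?G 1 v (x + d) - ?G (- 1) v (x - d)\<bar> \<le> \<bar>d\<bar> + K / sqrt v"
        using K3(2)[OF v, of x] unfolding power_one_right by linarith
    qed
    moreover have "K \<ge> 0" using K1(1) K2(1) K3(1) by (simp add: K_def)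
    ultimately show ?thesis unfolding d_def by blast
  qed
  then obtain K where K: "\<And>\<sigma>. \<sigma>\<^sup>2 = 1 \<Longrightarrow> K \<sigma> \<ge> 0 \<and> (\<forall>v\<ge>1. \<forall>x.
      \<bar>(?G 1 v (x + (\<alpha> + \<beta> * \<sigma>)) + ?G (- 1) v (x - (\<alpha> + \<beta> * \<sigma>))) / 2 - ?G \<sigma> (v + ?c) x\<bar>
        \<le> K \<sigma> / sqrt v ^ 3 \<and>
      \<bar>?G \<sigma> v x - heat_deriv 0 v x\<bar> \<le> K \<sigma> \<and>
      \<bar>?G 1 v (x + (\<alpha> + \<beta> * \<sigma>)) - ?G (- 1) v (x - (\<alpha> + \<beta> * \<sigma>))\<bar>
        \<le> \<bar>\<alpha> + \<beta> * \<sigma>\<bar> + K \<sigma> / sqrt v)"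
    by metis
  have nonneg: "K 1 \<ge> 0" "K (- 1) \<ge> 0" using K by simp_all
  show thesis
  proof (rule that[of "K 1 + K (- 1)"])
    fix \<sigma> v x :: real
    assume \<sigma>: "\<sigma> \<in> {-1, 1}" and v: "v \<ge> 1"
    then have "\<sigma>\<^sup>2 = 1" by auto
    have le: "K \<sigma> \<le> K 1 + K (- 1)" using \<sigma> nonneg by auto
    then have le': "K \<sigma> / sqrt v ^ n \<le> (K 1 + K (- 1)) / sqrt v ^ n" for n
      using v by (intro divide_right_mono) auto
    note * = conjunct2[OF K[OF \<open>\<sigma>\<^sup>2 = 1\<close>], rule_format, OF v, of x]
    show "\<bar>(?G 1 v (x + (\<alpha> + \<beta> * \<sigma>)) + ?G (- 1) v (x - (\<alpha> + \<beta> * \<sigma>))) / 2 - ?G \<sigma> (v + ?c) x\<bar>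
        \<le> (K 1 + K (- 1)) / sqrt v ^ 3"
      using * le'[of 3] by linarith
    show "\<bar>?G \<sigma> v x - heat_deriv 0 v x\<bar> \<le> K 1 + K (- 1)"
      using * le by linarith
    show "\<bar>?G 1 v (x + (\<alpha> + \<beta> * \<sigma>)) - ?G (- 1) v (x - (\<alpha> + \<beta> * \<sigma>))\<bar>
        \<le> \<bar>\<alpha> + \<beta> * \<sigma>\<bar> + (K 1 + K (- 1)) / sqrt v"
      using * le'[of 1] unfolding power_one_right by linarith
  qed (use nonneg in simp)
qed

text \<open>
  The barriers are the corrected heat solution, started at a variance \<open>v0\<close> and shifted by
  \<open>\<plusminus>(B - L/\<surd>v)\<close>. The term with \<open>L\<close> absorbs the one-step errors, \<open>B\<close> the initial mismatch.
\<close>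

lemma value_steps_near_heat:
  fixes q r :: "nat \<Rightarrow> real"
  assumes "\<forall>m\<in>{0, 1}. \<bar>q m\<bar> < 1" and "\<forall>m\<in>{0, 1}. \<bar>r m\<bar> < 1"
    and "\<exists>m\<in>{0, 1}. q m \<noteq> r m"
  obtains C where "\<And>\<epsilon> N m \<xi> \<eta>. \<epsilon> > 0 \<Longrightarrow> m \<in> {0, 1} \<Longrightarrow>
    \<bar>value_steps q r classic_data \<epsilon> N m \<xi> \<eta>
      - (\<eta> / 2 + \<epsilon> * heat_deriv 0 (C1_sharp q r * real N) (\<xi> / \<epsilon>))\<bar> \<le> C * \<epsilon>"
proof -
  define \<alpha> \<beta> where "\<alpha> = ((q 1 - r 1) + (q 0 - r 0)) / 2" and "\<beta> = ((q 1 - r 1) - (q 0 - r 0)) / 2"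
  define sg where "sg m = (if m = 1 then 1 else - 1 :: real)" for m :: nat
  define c where "c = C1_sharp q r"
  have c: "c = \<alpha>\<^sup>2 + \<beta>\<^sup>2"
    by (simp add: c_def C1_sharp_def \<alpha>_def \<beta>_def power2_eq_square field_simps)
  have "c > 0"
    using assms(3) by (auto simp: c_def C1_sharp_def add_pos_nonneg add_nonneg_pos)
  have d: "q m - r m = \<alpha> + \<beta> * sg m" if "m \<in> {0, 1}" for m
    using that by (auto simp: \<alpha>_def \<beta>_def sg_def field_simps)
  have sg: "sg m \<in> {-1, 1}" for m by (simp add: sg_def)
  have sg01: "sg 1 = 1" "sg 0 = - 1" by (simp_all add: sg_def)
  let ?G = "corrected_heat \<alpha> \<beta>"
  obtain K where "K \<ge> 0"
    and step: "\<And>\<sigma> v x. \<sigma> \<in> {-1, 1} \<Longrightarrow> v \<ge> 1 \<Longrightarrow>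
      \<bar>(?G 1 v (x + (\<alpha> + \<beta> * \<sigma>)) + ?G (- 1) v (x - (\<alpha> + \<beta> * \<sigma>))) / 2 - ?G \<sigma> (v + c) x\<bar> \<le> K / sqrt v ^ 3"
    and near: "\<And>\<sigma> v x. \<sigma> \<in> {-1, 1} \<Longrightarrow> v \<ge> 1 \<Longrightarrow> \<bar>?G \<sigma> v x - heat_deriv 0 v x\<bar> \<le> K"
    and spread: "\<And>\<sigma> v x. \<sigma> \<in> {-1, 1} \<Longrightarrow> v \<ge> 1 \<Longrightarrow>
      \<bar>?G 1 v (x + (\<alpha> + \<beta> * \<sigma>)) - ?G (- 1) v (x - (\<alpha> + \<beta> * \<sigma>))\<bar> \<le> \<bar>\<alpha> + \<beta> * \<sigma>\<bar> + K / sqrt v"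
    by (rule corrected_heat_bounds[of \<alpha> \<beta>, folded c, OF \<open>c > 0\<close>]) (rule that)
  define \<delta> where "\<delta> = 1 - Max {\<bar>q 0\<bar>, \<bar>q 1\<bar>, \<bar>r 0\<bar>, \<bar>r 1\<bar>}"
  have "\<delta> > 0" using assms(1,2) by (simp add: \<delta>_def)
  have \<delta>: "\<bar>q m\<bar> \<le> 1 - \<delta>" "\<bar>r m\<bar> \<le> 1 - \<delta>" if "m \<in> {0, 1}" for m
    using that by (auto simp: \<delta>_def le_max_iff_disj)
  \<comment> \<open>At this variance and beyond it the correction to the optimal \<open>f\<close> is at most the slack \<open>\<delta>\<close>.\<close>
  define v0 where "v0 = 1 + (K / (2 * \<delta>))\<^sup>2"
  have "v0 \<ge> 1" by (simp add: v0_def)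
  have late: "K / sqrt v \<le> 2 * \<delta>" if "v \<ge> v0" for v
  proof -
    have "(K / (2 * \<delta>))\<^sup>2 \<le> v" using that by (simp add: v0_def)
    then have "K / (2 * \<delta>) \<le> sqrt v" by (rule real_le_rsqrt)
    then show ?thesis using \<open>\<delta> > 0\<close> that \<open>v0 \<ge> 1\<close> by (simp add: field_simps)
  qed
  define L where "L = K * (2 * (1 + c) / c)"
  have "L \<ge> 0" using \<open>K \<ge> 0\<close> \<open>c > 0\<close> by (simp add: L_def)
  have L: "K / sqrt v ^ 3 \<le> L / sqrt v - L / sqrt (v + c)" if "v \<ge> 1" for v
    using mult_left_mono[OF power_decay_telescopes[OF \<open>c > 0\<close> that] \<open>K \<ge> 0\<close>]
    by (simp add: L_def right_diff_distrib)
  define B where "B = K + sqrt v0 + L"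
  define v where "v N = v0 + c * real N" for N
  have v: "v N \<ge> v0" "v N \<ge> 1" "v (Suc N) = v N + c" for N
    using \<open>c > 0\<close> \<open>v0 \<ge> 1\<close> by (auto simp: v_def algebra_simps intro: add_increasing2)
  have Lv: "0 \<le> L / sqrt (v N)" "L / sqrt (v N) \<le> L" for N
    using \<open>L \<ge> 0\<close> v(2)[of N] by (auto simp: divide_le_eq mult_le_cancel_left1)
  define G where "G N m x = ?G (sg m) (v N) x" for N m x
  have G_step: "\<bar>(G N 1 (x + (q m - r m)) + G N 0 (x - (q m - r m))) / 2 - G (Suc N) m x\<bar>
      \<le> L / sqrt (v N) - L / sqrt (v (Suc N))" if "m \<in> {0, 1}" for N m x
    using order_trans[OF step[OF sg[of m] v(2)[of N], of x] L[OF v(2)[of N]]]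
    unfolding G_def d[OF that] v(3) sg01 .
  have G_init: "\<bar>G 0 m x - \<bar>x\<bar> / 2\<bar> \<le> K + sqrt v0" for m x
    using near[OF sg[of m] v(2)[of 0], of x] heat_deriv_0_initial[of v0 x] \<open>v0 \<ge> 1\<close>
    unfolding G_def v_def by (simp del: heat_deriv.simps)
  have G_near: "\<bar>G N m x - heat_deriv 0 (c * real N) x\<bar> \<le> K + sqrt v0" for N m x
    using near[OF sg[of m] v(2)[of N], of x] heat_deriv_0_late_start[of v0 "c * real N" x] \<open>v0 \<ge> 1\<close> \<open>c > 0\<close>
    unfolding G_def v_def by (simp del: heat_deriv.simps)
  \<comment> \<open>\<open>\<bar>q + r\<bar> + \<bar>q - r\<bar> = 2 max \<bar>q\<bar> \<bar>r\<bar>\<close> leaves a slack of \<open>2\<delta>\<close>.\<close>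
  have move: "\<bar>q m + r m + (G N 1 (x + (q m - r m)) - G N 0 (x - (q m - r m)))\<bar> \<le> 2"
    if "m \<in> {0, 1}" for N m x
  proof -
    have "\<bar>G N 1 (x + (q m - r m)) - G N 0 (x - (q m - r m))\<bar> \<le> \<bar>q m - r m\<bar> + 2 * \<delta>"
      using spread[OF sg[of m] v(2)[of N], of x] late[OF v(1)[of N]]
      unfolding G_def d[OF that] sg01 by linarith
    then show ?thesis using \<delta>[OF that] by linarith
  qed
  have arith: "(a + B - l + (b + B - l)) / 2 \<le> g + B - l'"
      "g - B + l' \<le> (a - B + l + (b - B + l)) / 2"
    if "\<bar>(a + b) / 2 - g\<bar> \<le> l - l'" for a b g l l' :: real
    using that by (simp_all add: abs_le_iff field_simps)
  show thesis
  proof (rule that[of "B + L + K + sqrt v0"])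
    fix \<epsilon> \<xi> \<eta> :: real and N m :: nat
    assume \<epsilon>: "\<epsilon> > 0" and m: "m \<in> {0, 1}"
    let ?u = "value_steps q r classic_data \<epsilon> N m \<xi> \<eta>" and ?h = "heat_deriv 0 (c * real N) (\<xi> / \<epsilon>)"
    have "?u \<le> \<eta> / 2 + \<epsilon> * (G N m (\<xi> / \<epsilon>) + B - L / sqrt (v N))"
    proof (rule value_steps_le[OF \<epsilon> m, where W = "\<lambda>N m x. G N m x + B - L / sqrt (v N)"])
      show "\<bar>x\<bar> / 2 \<le> G 0 m x + B - L / sqrt (v 0)" for m x
        using G_init[of m x] Lv[of 0] unfolding B_def by linarith
    next
      fix N m :: nat and x :: real assume m: "m \<in> {0, 1}"
      show "\<bar>q m + r m + (G N 1 (x + (q m - r m)) + B - L / sqrt (v N)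
          - (G N 0 (x - (q m - r m)) + B - L / sqrt (v N)))\<bar> \<le> 2"
        using move[OF m, of N x] by (simp add: algebra_simps)
      show "(G N 1 (x + (q m - r m)) + B - L / sqrt (v N)
          + (G N 0 (x - (q m - r m)) + B - L / sqrt (v N))) / 2 \<le> G (Suc N) m x + B - L / sqrt (v (Suc N))"
        by (rule arith(1)[OF G_step[OF m]])
    qed
    moreover have "\<eta> / 2 + \<epsilon> * (G N m (\<xi> / \<epsilon>) - B + L / sqrt (v N)) \<le> ?u"
    proof (rule value_steps_ge[OF \<epsilon> m, where W = "\<lambda>N m x. G N m x - B + L / sqrt (v N)"])
      show "G 0 m x - B + L / sqrt (v 0) \<le> \<bar>x\<bar> / 2" for m x
        using G_init[of m x] Lv[of 0] unfolding B_def by linarith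
    next
      fix N m :: nat and x :: real assume m: "m \<in> {0, 1}"
      show "G (Suc N) m x - B + L / sqrt (v (Suc N))
          \<le> (G N 1 (x + (q m - r m)) - B + L / sqrt (v N)
            + (G N 0 (x - (q m - r m)) - B + L / sqrt (v N))) / 2"
        by (rule arith(2)[OF G_step[OF m]])
    qed
    moreover have "\<epsilon> * (G N m (\<xi> / \<epsilon>) + B - L / sqrt (v N)) \<le> \<epsilon> * (?h + (B + L + K + sqrt v0))"
      using G_near[of N m "\<xi> / \<epsilon>"] Lv[of N] \<epsilon> \<open>L \<ge> 0\<close> by (intro mult_left_mono) linarith+
    moreover have "\<epsilon> * (?h - (B + L + K + sqrt v0)) \<le> \<epsilon> * (G N m (\<xi> / \<epsilon>) - B + L / sqrt (v N))"
      using G_near[of N m "\<xi> / \<epsilon>"] Lv[of N] \<epsilon> \<open>L \<ge> 0\<close> by (intro mult_left_mono) linarith+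
    ultimately have "\<bar>?u - (\<eta> / 2 + \<epsilon> * ?h)\<bar> \<le> (B + L + K + sqrt v0) * \<epsilon>"
      unfolding distrib_left right_diff_distrib abs_le_iff by (simp add: algebra_simps del: heat_deriv.simps)
    then show "\<bar>?u - (\<eta> / 2 + \<epsilon> * heat_deriv 0 (C1_sharp q r * real N) (\<xi> / \<epsilon>))\<bar>
        \<le> (B + L + K + sqrt v0) * \<epsilon>"
      unfolding c_def .
  qed
qed

theorem theorem3p3:
  fixes q r :: "nat \<Rightarrow> real"
  assumes "\<forall>m\<in>{0, 1}. \<bar>q m\<bar> < 1" and "\<forall>m\<in>{0, 1}. \<bar>r m\<bar> < 1"
    and "\<exists>m\<in>{0, 1}. q m \<noteq> r m"
  shows "\<exists>C::real. \<exists>\<epsilon>\<^sub>0>0. \<forall>\<epsilon> T t \<xi> \<eta>. \<forall>m\<in>{0, 1}.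
    0 < \<epsilon> \<and> \<epsilon> < \<epsilon>\<^sub>0 \<and> t < T \<and> (T - t) / \<epsilon>\<^sup>2 \<in> \<nat> \<longrightarrow>
      \<bar>u_eps q r classic_data \<epsilon> T t m \<xi> \<eta> - classic_solution (C1_sharp q r) T t \<xi> \<eta>\<bar>
        \<le> C * \<epsilon> * \<bar>ln \<epsilon>\<bar>"
proof -
  obtain C where C: "\<And>\<epsilon> N m \<xi> \<eta>. \<epsilon> > 0 \<Longrightarrow> m \<in> {0, 1} \<Longrightarrow>
    \<bar>value_steps q r classic_data \<epsilon> N m \<xi> \<eta>
      - (\<eta> / 2 + \<epsilon> * heat_deriv 0 (C1_sharp q r * real N) (\<xi> / \<epsilon>))\<bar> \<le> C * \<epsilon>"
    using assms by (rule value_steps_near_heat) (rule that)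
  show ?thesis
  \<comment> \<open>The estimate holds with \<open>C\<epsilon>\<close>; below \<open>exp (-1)\<close> the factor \<open>\<bar>ln \<epsilon>\<bar>\<close> is at least 1.\<close>
  proof (rule exI[of _ C], rule exI[of _ "exp (- 1)"], intro conjI allI ballI impI)
    fix \<epsilon> T t \<xi> \<eta> :: real and m :: nat
    assume m: "m \<in> {0, 1}" and A: "0 < \<epsilon> \<and> \<epsilon> < exp (- 1) \<and> t < T \<and> (T - t) / \<epsilon>\<^sup>2 \<in> \<nat>"
    then obtain N where N: "(T - t) / \<epsilon>\<^sup>2 = real N"
      by (auto elim: Nats_cases)
    have "C1_sharp q r \<ge> 0" by (simp add: C1_sharp_def)
    then have "heat_solution (C1_sharp q r) T t \<xi>
        = \<epsilon> * heat_deriv 0 (C1_sharp q r * real N) (\<xi> / \<epsilon>)"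
      using A N by (intro heat_solution_scaled) (auto simp: field_simps)
    then have le: "\<bar>u_eps q r classic_data \<epsilon> T t m \<xi> \<eta> - classic_solution (C1_sharp q r) T t \<xi> \<eta>\<bar> \<le> C * \<epsilon>"
      using C[of \<epsilon> m N \<xi> \<eta>] A m N by (simp add: u_eps_def classic_solution_def del: heat_deriv.simps)
    then have "0 \<le> C * \<epsilon>" by linarith
    moreover have "1 \<le> \<bar>ln \<epsilon>\<bar>"
      using A ln_less_cancel_iff[of \<epsilon> "exp (- 1)"] by simp
    ultimately have "C * \<epsilon> * 1 \<le> C * \<epsilon> * \<bar>ln \<epsilon>\<bar>" by (rule mult_left_mono[rotated])
    with le show "\<bar>u_eps q r classic_data \<epsilon> T t m \<xi> \<eta> - classic_solution (C1_sharp q r) T t \<xi> \<eta>\<bar>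
        \<le> C * \<epsilon> * \<bar>ln \<epsilon>\<bar>" by linarith
  qed simp
qed

end
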